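(* Let $M=\mathbb{R}^n/\mathbb{Z}^n$, let $\kappa,\nu,\varepsilon\ge 0$ be constants, let $\mathcal{U}$ be a given smooth real function of density, let $\xi_r$ be fixed divergence-free vector fields on $M$, and let $(W^r)_r$ be independent real Brownian motions. Let $(\mu_t,\rho_t)$ be a pair consisting of a stochastic time-dependent vector field $\mu$ on $M$ and a stochastic time-dependent function $\rho$ on $M$; write $\bar\mu=E[\mu]$, $\bar\rho=E[\rho]$, $u=\bar\mu/\bar\rho$, and suppose that $(\mu,\rho)$ is a solution of the mean field Stratonovich system $$ \begin{aligned} \delta_t\mu &= \Big(-\nabla_{u+\nu\nabla\log\bar\rho}\,\mu-\operatorname{div}(u+\nu\nabla\log\bar\rho)\,\mu-(\nabla^{\top}u)\mu-\nu(\nabla^{\top}\nabla\log\bar\rho)\mu\\ &\qquad+\rho(\nabla^{\top}u)u-\rho\bar\rho^{-1}\nabla\big(\bar\rho^2\,\mathcal{U}'(\bar\rho)\big)+\kappa\rho\nabla\Delta\bar\rho\\ &\qquad-\nu\rho\bar\rho^{-2}\operatorname{div}(\bar\mu)\nabla\bar\rho+\nu\rho\bar\rho^{-1}\nabla\operatorname{div}(\bar\mu)\Big)\,\delta_t t\;-\;\varepsilon\sum_r \operatorname{ad}(\xi_r)^{\top}\mu\;\delta_t W^r,\\ \delta_t\rho &= -\operatorname{div}\big(\rho u+\nu\rho\nabla\log\bar\rho\big)\,\delta_t t\;-\;\varepsilon\sum_r\operatorname{div}(\rho\,\xi_r)\;\delta_t W^r. \end{aligned} $$ Let $\Phi_t$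 be the stochastic Lagrangian flow of diffeomorphisms of $M$ characterized by $$ (\delta_t\Phi_t)\circ\Phi_t^{-1}=\big(u_t+\nu\nabla\log\bar\rho_t\big)\,\delta_t t+\varepsilon\sum_r\xi_r\,\delta_tW^r_t , $$ with the same Brownian motions $W^r$, and let $C$ be a smooth closed loop in $M$, transported by $\Phi_t$ to the loop $(\Phi_t)_*C$. Then $$ \delta_t\int_{(\Phi_t)_*C}\rho_t^{-1}\mu_t^{\flat}=0, $$ where $\mu_t^{\flat}$ is the one-form on $M$ corresponding to the vector field $\mu_t$ under the Euclidean metric.
   Context: Vector calculus on $M=\mathbb{R}^n/\mathbb{Z}^n$: $e_1,\dots,e_n$ is the standard basis and $\langle\cdot,\cdot\rangle$ the Euclidean inner product. For vector fields $X,Y$: $\nabla_XY=\sum_{i,j}X^i(\partial_iY^j)e_j$ and $(\nabla^{\top}X)Y=\sum_{i,j}(\partial_iX^j)Y^je_i$. The Lie derivative is $L_XY=\nabla_XY-\nabla_YX$, $\operatorname{ad}(X)Y=-L_XY$, and $\top$ denotes the adjoint with respect to the $L^2$ inner product $\int_M\langle X,Y\rangle\,dx$; explicitly $$\operatorname{ad}(X)^{\top}Y=-L_X^{\top}Y=\nabla_XY+\operatorname{div}(X)Y+(\nabla^{\top}X)Y.$$ $\Delta$ is the Laplacian. Stochastic notation: all processes live on a filtered probability space satisfying the usual conditions and are adapted; $\delta_t$ denotes the Stratonovich differential in time, and $\delta_t t$ is ordinary $dt$. The $\xi_r$ are deterministic and time-independent. $E$ denotes expectation; $\bar\mu$, $\bar\rho$,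 $u$ are deterministic time-dependent fields. The equation for $\Phi_t$ means $\delta_t\Phi_t=(u_t+\nu\nabla\log\bar\rho_t)\circ\Phi_t\,\delta_tt+\varepsilon\sum_r\xi_r\circ\Phi_t\,\delta_tW^r_t$. If $C$ is parameterized by a closed curve $c:[0,1]\to M$, then $(\Phi_t)_*C$ is parameterized by $\Phi_t\circ c$. The conclusion says that the circulation process $t\mapsto\int_{(\Phi_t)_*C}\rho_t^{-1}\mu_t^{\flat}$ has vanishing Stratonovich differential, i.e. is constant in time. Conventions on solutions: $\rho>0$ and $\bar\rho>0$, and $\mu,\rho,\Phi$ are assumed regular enough that every term of the equations makes sense and that the Stratonovich chain rule (including the Itô–Wentzell type formula for composition with the flow) applies. *)

theory Defs
  imports "HOL-Probability.Probability"
begin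

section \<open>Differentiability classes\<close>

text \<open>Meant for open sets \<open>S\<close>; continuity of the lower derivatives is implied by differentiability.\<close>

fun Ck_on :: "nat \<Rightarrow> 'a::euclidean_space set \<Rightarrow> ('a \<Rightarrow> 'b::real_normed_vector) \<Rightarrow> bool" where
  "Ck_on 0 S f = continuous_on S f"
| "Ck_on (Suc k) S f =
     ((\<forall>x\<in>S. f differentiable (at x)) \<and>
      (\<forall>b\<in>Basis. Ck_on k S (\<lambda>x. frechet_derivative f (at x) b)))"

definition smooth_on :: "'a::euclidean_space set \<Rightarrow> ('a \<Rightarrow> 'b::real_normed_vector) \<Rightarrow> bool" where
  "smooth_on S f \<longleftrightarrow> (\<forall>k. Ck_on k S f)"

text \<open>Time-dependent fields on \<open>[0,T]\<close>: \<open>k\<close> times differentiable in space, with all spatial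
  derivatives of order at most \<open>k\<close> jointly continuous in time and space.\<close>

fun time_Ck :: "nat \<Rightarrow> real \<Rightarrow> (real \<Rightarrow> 'a::euclidean_space \<Rightarrow> 'b::real_normed_vector) \<Rightarrow> bool" where
  "time_Ck 0 T G = continuous_on ({0..T} \<times> UNIV) (\<lambda>(t, x). G t x)"
| "time_Ck (Suc k) T G =
     (continuous_on ({0..T} \<times> UNIV) (\<lambda>(t, x). G t x) \<and>
      (\<forall>t\<in>{0..T}. \<forall>x. G t differentiable (at x)) \<and>
      (\<forall>b\<in>Basis. time_Ck k T (\<lambda>t x. frechet_derivative (G t) (at x) b)))"


section \<open>Vector calculus on the torus\<close>

text \<open>The torus \<open>R^n / Z^n\<close> is handled through its universal cover: functions and vector fields
  on it are the \<open>Z^n\<close>-periodic ones on \<open>real ^ 'n\<close>. A diffeomorphism of the torus that is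
  isotopic to the identity lifts to a diffeomorphism commuting with \<open>Z^n\<close>-translations,
  and a closed curve lifts to a curve whose end points differ by an element of \<open>Z^n\<close>.\<close>

definition int_lattice :: "(real ^ 'n) set" where
  "int_lattice = {k. \<forall>i. k $ i \<in> \<int>}"

definition periodic :: "(real ^ 'n \<Rightarrow> 'b) \<Rightarrow> bool" where
  "periodic f \<longleftrightarrow> (\<forall>x. \<forall>k\<in>int_lattice. f (x + k) = f x)"

definition torus_diffeo :: "(real ^ 'n \<Rightarrow> real ^ 'n) \<Rightarrow> bool" where
  "torus_diffeo \<phi> \<longleftrightarrow>
     bij \<phi> \<and> Ck_on 1 UNIV \<phi> \<and> Ck_on 1 UNIV (inv \<phi>) \<and>
     (\<forall>x. \<forall>k\<in>int_lattice. \<phi> (x + k) = \<phi> x + k)"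

definition partial_d :: "'n \<Rightarrow> (real ^ 'n \<Rightarrow> real) \<Rightarrow> real ^ 'n \<Rightarrow> real" where
  "partial_d i f x = frechet_derivative f (at x) (axis i 1)"

definition grad :: "(real ^ 'n \<Rightarrow> real) \<Rightarrow> real ^ 'n \<Rightarrow> real ^ 'n" where
  "grad f x = (\<chi> i. partial_d i f x)"

definition divg :: "(real ^ 'n \<Rightarrow> real ^ 'n) \<Rightarrow> real ^ 'n \<Rightarrow> real" where
  "divg X x = (\<Sum>i\<in>UNIV. partial_d i (\<lambda>y. X y $ i) x)"

definition laplacian :: "(real ^ 'n \<Rightarrow> real) \<Rightarrow> real ^ 'n \<Rightarrow> real" where
  "laplacian f = divg (grad f)"

definition nabla :: "(real ^ 'n \<Rightarrow> real ^ 'n) \<Rightarrow> (real ^ 'n \<Rightarrow> real ^ 'n) \<Rightarrow> real ^ 'n \<Rightarrow> real ^ 'n" where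
  "nabla X Y x = (\<chi> j. \<Sum>i\<in>UNIV. X x $ i * partial_d i (\<lambda>y. Y y $ j) x)"

definition nabla_transpose ::
    "(real ^ 'n \<Rightarrow> real ^ 'n) \<Rightarrow> (real ^ 'n \<Rightarrow> real ^ 'n) \<Rightarrow> real ^ 'n \<Rightarrow> real ^ 'n" where
  "nabla_transpose X Y x = (\<chi> i. \<Sum>j\<in>UNIV. partial_d i (\<lambda>y. X y $ j) x * Y x $ j)"

text \<open>The explicit form of the \<open>L^2\<close>-adjoint of \<open>ad X = - L\<^sub>X\<close>, where
  \<open>L\<^sub>X Y = nabla X Y - nabla Y X\<close>.\<close>

definition ad_transpose ::
    "(real ^ 'n \<Rightarrow> real ^ 'n) \<Rightarrow> (real ^ 'n \<Rightarrow> real ^ 'n) \<Rightarrow> real ^ 'n \<Rightarrow> real ^ 'n" where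
  "ad_transpose X Y x = nabla X Y x + divg X x *\<^sub>R Y x + nabla_transpose X Y x"

text \<open>One-forms are given by their values on a tangent vector at a point.\<close>

definition flat_form :: "(real ^ 'n \<Rightarrow> real ^ 'n) \<Rightarrow> real ^ 'n \<Rightarrow> real ^ 'n \<Rightarrow> real" where
  "flat_form X x h = X x \<bullet> h"

definition line_integral :: "(real ^ 'n \<Rightarrow> real ^ 'n \<Rightarrow> real) \<Rightarrow> (real \<Rightarrow> real ^ 'n) \<Rightarrow> real" where
  "line_integral \<alpha> \<gamma> =
     integral {0..1} (\<lambda>s. \<alpha> (\<gamma> s) (vector_derivative \<gamma> (at s within {0..1})))"


section \<open>Filtrations and Brownian motions\<close>

text \<open>Filtrations are indexed by \<open>real\<close>, but only times \<open>t \<ge> 0\<close> matter.\<close>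

definition usual_conditions :: "'w measure \<Rightarrow> (real \<Rightarrow> 'w measure) \<Rightarrow> bool" where
  "usual_conditions M F \<longleftrightarrow>
     filtration (space M) F \<and>
     (\<forall>t. subalgebra M (F t)) \<and>
     (\<forall>t\<ge>0. sets (F t) = (\<Inter>s\<in>{t<..}. sets (F s))) \<and>
     (\<forall>N\<in>null_sets M. \<forall>A. A \<subseteq> N \<longrightarrow> A \<in> sets (F 0))"

definition adapted_on ::
    "(real \<Rightarrow> 'w measure) \<Rightarrow> real \<Rightarrow> (real \<Rightarrow> 'w \<Rightarrow> 'v::euclidean_space) \<Rightarrow> bool" where
  "adapted_on F T X \<longleftrightarrow> (\<forall>t\<in>{0..T}. X t \<in> borel_measurable (F t))"

definition brownian_motion :: "'w measure \<Rightarrow> (real \<Rightarrow> 'w measure) \<Rightarrow> (real \<Rightarrow> 'w \<Rightarrow> real) \<Rightarrow> bool" where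
  "brownian_motion M F B \<longleftrightarrow>
     (\<forall>t\<ge>0. B t \<in> borel_measurable (F t)) \<and>
     (AE \<omega> in M. B 0 \<omega> = 0) \<and>
     (\<forall>\<omega>\<in>space M. continuous_on {0..} (\<lambda>t. B t \<omega>)) \<and>
     (\<forall>s t. 0 \<le> s \<and> s < t \<longrightarrow>
        distributed M lborel (\<lambda>\<omega>. B t \<omega> - B s \<omega>) (normal_density 0 (sqrt (t - s))) \<and>
        prob_space.indep_set M (sets (F s))
          (sets (vimage_algebra (space M) (\<lambda>\<omega>. B t \<omega> - B s \<omega>) borel)))"

definition independent_brownian_motions ::
    "'w measure \<Rightarrow> (real \<Rightarrow> 'w measure) \<Rightarrow> 'r set \<Rightarrow> ('r \<Rightarrow> real \<Rightarrow> 'w \<Rightarrow> real) \<Rightarrow> bool" where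
  "independent_brownian_motions M F R W \<longleftrightarrow>
     (\<forall>r\<in>R. brownian_motion M F (W r)) \<and>
     prob_space.indep_vars M (\<lambda>_. PiM {0..} (\<lambda>_. borel)) (\<lambda>r \<omega>. \<lambda>t\<in>{0..}. W r t \<omega>) R"


section \<open>Stratonovich differentials\<close>

definition time_partition :: "real \<Rightarrow> nat \<Rightarrow> (nat \<Rightarrow> real) \<Rightarrow> bool" where
  "time_partition t N \<tau> \<longleftrightarrow> \<tau> 0 = 0 \<and> \<tau> N = t \<and> (\<forall>i<N. \<tau> i \<le> \<tau> (Suc i))"

definition stratonovich_sum ::
    "nat \<Rightarrow> (nat \<Rightarrow> real) \<Rightarrow> (real \<Rightarrow> 'w \<Rightarrow> 'v::euclidean_space) \<Rightarrow> (real \<Rightarrow> 'w \<Rightarrow> real) \<Rightarrow> 'w \<Rightarrow> 'v" where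
  "stratonovich_sum N \<tau> Y B \<omega> =
     (\<Sum>i<N. (B (\<tau> (Suc i)) \<omega> - B (\<tau> i) \<omega>) *\<^sub>R ((1/2) *\<^sub>R (Y (\<tau> i) \<omega> + Y (\<tau> (Suc i)) \<omega>)))"

text \<open>The Stratonovich integral of an adapted process \<open>Y\<close> against \<open>B\<close> over \<open>[0,t]\<close>: the limit in
  probability of the trapezoidal sums as the mesh of the partition tends to zero.\<close>

definition has_stratonovich_integral ::
    "'w measure \<Rightarrow> (real \<Rightarrow> 'w measure) \<Rightarrow> real \<Rightarrow> (real \<Rightarrow> 'w \<Rightarrow> 'v::euclidean_space) \<Rightarrow>
     (real \<Rightarrow> 'w \<Rightarrow> real) \<Rightarrow> ('w \<Rightarrow> 'v) \<Rightarrow> bool" where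
  "has_stratonovich_integral M F t Y B J \<longleftrightarrow>
     adapted_on F t Y \<and> adapted_on F t B \<and> J \<in> borel_measurable M \<and>
     (\<forall>\<eta>>0. \<forall>p>0. \<exists>\<delta>>0. \<forall>N \<tau>.
        time_partition t N \<tau> \<and> (\<forall>i<N. \<tau> (Suc i) - \<tau> i < \<delta>) \<longrightarrow>
        measure M {\<omega> \<in> space M. norm (stratonovich_sum N \<tau> Y B \<omega> - J \<omega>) > \<eta>} < p)"

text \<open>On \<open>[0,T]\<close>, \<open>\<delta>\<^sub>t X = a \<delta>\<^sub>t t + (\<Sum>r\<in>R. b r \<delta>\<^sub>t W\<^sup>r)\<close>, which stands for the integrated equation.\<close>

definition has_stratonovich_differential ::
    "'w measure \<Rightarrow> (real \<Rightarrow> 'w measure) \<Rightarrow> 'r set \<Rightarrow> ('r \<Rightarrow> real \<Rightarrow> 'w \<Rightarrow> real) \<Rightarrow> real \<Rightarrow>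
     (real \<Rightarrow> 'w \<Rightarrow> 'v::euclidean_space) \<Rightarrow> (real \<Rightarrow> 'w \<Rightarrow> 'v) \<Rightarrow> ('r \<Rightarrow> real \<Rightarrow> 'w \<Rightarrow> 'v) \<Rightarrow> bool" where
  "has_stratonovich_differential M F R W T X a b \<longleftrightarrow>
     (\<forall>t\<in>{0..T}.
        (AE \<omega> in M. set_integrable lborel {0..t} (\<lambda>s. a s \<omega>)) \<and>
        (\<exists>J. (\<forall>r\<in>R. has_stratonovich_integral M F t (b r) (W r) (J r)) \<and>
             (AE \<omega> in M. X t \<omega> = X 0 \<omega> + (LINT s:{0..t}|lborel. a s \<omega>) + (\<Sum>r\<in>R. J r \<omega>))))"

text \<open>For a random time-dependent field \<open>G\<close> the equation is required at every point of space.\<close>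

definition has_field_differential ::
    "'w measure \<Rightarrow> (real \<Rightarrow> 'w measure) \<Rightarrow> 'r set \<Rightarrow> ('r \<Rightarrow> real \<Rightarrow> 'w \<Rightarrow> real) \<Rightarrow> real \<Rightarrow>
     (real \<Rightarrow> 'w \<Rightarrow> real ^ 'n \<Rightarrow> 'v::euclidean_space) \<Rightarrow> (real \<Rightarrow> 'w \<Rightarrow> real ^ 'n \<Rightarrow> 'v) \<Rightarrow>
     ('r \<Rightarrow> real \<Rightarrow> 'w \<Rightarrow> real ^ 'n \<Rightarrow> 'v) \<Rightarrow> bool" where
  "has_field_differential M F R W T G A B \<longleftrightarrow>
     (\<forall>x. has_stratonovich_differential M F R W T
            (\<lambda>t \<omega>. G t \<omega> x) (\<lambda>t \<omega>. A t \<omega> x) (\<lambda>r t \<omega>. B r t \<omega> x))"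

text \<open>\<open>\<delta>\<^sub>t \<Phi> = v \<circ> \<Phi> \<delta>\<^sub>t t + (\<Sum>r\<in>R. \<zeta> r \<circ> \<Phi> \<delta>\<^sub>t W\<^sup>r)\<close> with \<open>\<Phi>\<close> starting at the identity.\<close>

definition stochastic_flow ::
    "'w measure \<Rightarrow> (real \<Rightarrow> 'w measure) \<Rightarrow> 'r set \<Rightarrow> ('r \<Rightarrow> real \<Rightarrow> 'w \<Rightarrow> real) \<Rightarrow> real \<Rightarrow>
     (real \<Rightarrow> 'w \<Rightarrow> real ^ 'n \<Rightarrow> real ^ 'n) \<Rightarrow> (real \<Rightarrow> real ^ 'n \<Rightarrow> real ^ 'n) \<Rightarrow>
     ('r \<Rightarrow> real ^ 'n \<Rightarrow> real ^ 'n) \<Rightarrow> bool" where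
  "stochastic_flow M F R W T \<Phi> v \<zeta> \<longleftrightarrow>
     (\<forall>\<omega>\<in>space M. \<Phi> 0 \<omega> = id \<and> (\<forall>t\<in>{0..T}. torus_diffeo (\<Phi> t \<omega>))) \<and>
     (\<forall>x. adapted_on F T (\<lambda>t \<omega>. \<Phi> t \<omega> x)) \<and>
     has_field_differential M F R W T \<Phi> (\<lambda>t \<omega> x. v t (\<Phi> t \<omega> x)) (\<lambda>r t \<omega> x. \<zeta> r (\<Phi> t \<omega> x))"


section \<open>The rules of Stratonovich calculus\<close>

text \<open>The following predicates say that a rule of Stratonovich calculus is valid for given
  processes. The coefficients are explicit arguments, because the rules fail for
  arbitrary integrands for which the Stratonovich integral merely exists.\<close>

definition chain_rule_applies ::
    "'w measure \<Rightarrow> (real \<Rightarrow> 'w measure) \<Rightarrow> 'r set \<Rightarrow> ('r \<Rightarrow> real \<Rightarrow> 'w \<Rightarrow> real) \<Rightarrow> real \<Rightarrow>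
     (real \<Rightarrow> 'w \<Rightarrow> 'v::euclidean_space) \<Rightarrow> (real \<Rightarrow> 'w \<Rightarrow> 'v) \<Rightarrow> ('r \<Rightarrow> real \<Rightarrow> 'w \<Rightarrow> 'v) \<Rightarrow> bool" where
  "chain_rule_applies M F R W T Z a b \<longleftrightarrow>
     (has_stratonovich_differential M F R W T Z a b \<longrightarrow>
      (\<forall>S g. open S \<and> smooth_on S g \<and> (\<forall>t\<in>{0..T}. \<forall>\<omega>\<in>space M. Z t \<omega> \<in> S) \<longrightarrow>
         has_stratonovich_differential M F R W T
           (\<lambda>t \<omega>. (g :: 'v \<Rightarrow> real) (Z t \<omega>))
           (\<lambda>t \<omega>. frechet_derivative g (at (Z t \<omega>)) (a t \<omega>))
           (\<lambda>r t \<omega>. frechet_derivative g (at (Z t \<omega>)) (b r t \<omega>))))"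

text \<open>Derivative along a flow with velocity \<open>v\<close> of a field \<open>G\<close> whose rate of change at a fixed
  point is \<open>A\<close>.\<close>

definition material_derivative ::
    "(real ^ 'n \<Rightarrow> 'v::euclidean_space) \<Rightarrow> (real ^ 'n \<Rightarrow> 'v) \<Rightarrow> (real ^ 'n \<Rightarrow> real ^ 'n) \<Rightarrow>
     real ^ 'n \<Rightarrow> 'v" where
  "material_derivative G A v y = A y + frechet_derivative G (at y) (v y)"

text \<open>\<open>\<delta>\<^sub>t (G\<^sub>t \<circ> \<Phi>\<^sub>t) = (\<delta>\<^sub>t G\<^sub>t) \<circ> \<Phi>\<^sub>t + (D G\<^sub>t \<circ> \<Phi>\<^sub>t) \<delta>\<^sub>t \<Phi>\<^sub>t\<close>\<close>

definition ito_wentzell_applies ::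
    "'w measure \<Rightarrow> (real \<Rightarrow> 'w measure) \<Rightarrow> 'r set \<Rightarrow> ('r \<Rightarrow> real \<Rightarrow> 'w \<Rightarrow> real) \<Rightarrow> real \<Rightarrow>
     (real \<Rightarrow> 'w \<Rightarrow> real ^ 'n \<Rightarrow> 'v::euclidean_space) \<Rightarrow> (real \<Rightarrow> 'w \<Rightarrow> real ^ 'n \<Rightarrow> 'v) \<Rightarrow>
     ('r \<Rightarrow> real \<Rightarrow> 'w \<Rightarrow> real ^ 'n \<Rightarrow> 'v) \<Rightarrow>
     (real \<Rightarrow> 'w \<Rightarrow> real ^ 'n \<Rightarrow> real ^ 'n) \<Rightarrow> (real \<Rightarrow> real ^ 'n \<Rightarrow> real ^ 'n) \<Rightarrow>
     ('r \<Rightarrow> real ^ 'n \<Rightarrow> real ^ 'n) \<Rightarrow> bool" where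
  "ito_wentzell_applies M F R W T G A B \<Phi> v \<zeta> \<longleftrightarrow>
     (has_field_differential M F R W T G A B \<and> stochastic_flow M F R W T \<Phi> v \<zeta> \<longrightarrow>
      has_field_differential M F R W T
        (\<lambda>t \<omega> x. G t \<omega> (\<Phi> t \<omega> x))
        (\<lambda>t \<omega> x. material_derivative (G t \<omega>) (A t \<omega>) (v t) (\<Phi> t \<omega> x))
        (\<lambda>r t \<omega> x. material_derivative (G t \<omega>) (B r t \<omega>) (\<zeta> r) (\<Phi> t \<omega> x)))"

text \<open>The equation of a flow may be differentiated with respect to the initial point:
  \<open>\<delta>\<^sub>t (D \<Phi>\<^sub>t h) = D (\<delta>\<^sub>t \<Phi>\<^sub>t) h\<close>.\<close>

definition flow_derivative_applies ::
    "'w measure \<Rightarrow> (real \<Rightarrow> 'w measure) \<Rightarrow> 'r set \<Rightarrow> ('r \<Rightarrow> real \<Rightarrow> 'w \<Rightarrow> real) \<Rightarrow> real \<Rightarrow>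
     (real \<Rightarrow> 'w \<Rightarrow> real ^ 'n \<Rightarrow> real ^ 'n) \<Rightarrow> (real \<Rightarrow> real ^ 'n \<Rightarrow> real ^ 'n) \<Rightarrow>
     ('r \<Rightarrow> real ^ 'n \<Rightarrow> real ^ 'n) \<Rightarrow> bool" where
  "flow_derivative_applies M F R W T \<Phi> v \<zeta> \<longleftrightarrow>
     (stochastic_flow M F R W T \<Phi> v \<zeta> \<longrightarrow>
      (\<forall>h. has_field_differential M F R W T
         (\<lambda>t \<omega> x. frechet_derivative (\<Phi> t \<omega>) (at x) h)
         (\<lambda>t \<omega> x. frechet_derivative (\<lambda>y. v t (\<Phi> t \<omega> y)) (at x) h)
         (\<lambda>r t \<omega> x. frechet_derivative (\<lambda>y. \<zeta> r (\<Phi> t \<omega> y)) (at x) h)))"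


section \<open>The mean field system\<close>

definition mean_field ::
    "'w measure \<Rightarrow> (real \<Rightarrow> 'w \<Rightarrow> real ^ 'n \<Rightarrow> 'v::euclidean_space) \<Rightarrow> real \<Rightarrow> real ^ 'n \<Rightarrow> 'v" where
  "mean_field M G t x = (LINT \<omega>|M. G t \<omega> x)"

text \<open>In what follows \<open>mb\<close> and \<open>rb\<close> are the mean momentum and the mean density at a fixed time,
  \<open>m\<close> and \<open>q\<close> the random momentum and density at a fixed time and sample point.\<close>

definition mean_velocity ::
    "(real ^ 'n \<Rightarrow> real ^ 'n) \<Rightarrow> (real ^ 'n \<Rightarrow> real) \<Rightarrow> real ^ 'n \<Rightarrow> real ^ 'n" where
  "mean_velocity mb rb x = (1 / rb x) *\<^sub>R mb x"

definition transport_velocity ::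
    "real \<Rightarrow> (real ^ 'n \<Rightarrow> real ^ 'n) \<Rightarrow> (real ^ 'n \<Rightarrow> real) \<Rightarrow> real ^ 'n \<Rightarrow> real ^ 'n" where
  "transport_velocity \<nu> mb rb x = mean_velocity mb rb x + \<nu> *\<^sub>R grad (\<lambda>y. ln (rb y)) x"

definition momentum_drift ::
    "(real \<Rightarrow> real) \<Rightarrow> real \<Rightarrow> real \<Rightarrow> (real ^ 'n \<Rightarrow> real ^ 'n) \<Rightarrow> (real ^ 'n \<Rightarrow> real) \<Rightarrow>
     (real ^ 'n \<Rightarrow> real ^ 'n) \<Rightarrow> (real ^ 'n \<Rightarrow> real) \<Rightarrow> real ^ 'n \<Rightarrow> real ^ 'n" where
  "momentum_drift U \<kappa> \<nu> mb rb m q x =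
     (let u = mean_velocity mb rb; v = transport_velocity \<nu> mb rb in
      - nabla v m x - divg v x *\<^sub>R m x
      - nabla_transpose u m x - \<nu> *\<^sub>R nabla_transpose (grad (\<lambda>y. ln (rb y))) m x
      + q x *\<^sub>R nabla_transpose u u x
      - (q x / rb x) *\<^sub>R grad (\<lambda>y. (rb y)\<^sup>2 * deriv U (rb y)) x
      + (\<kappa> * q x) *\<^sub>R grad (laplacian rb) x
      - (\<nu> * q x / (rb x)\<^sup>2 * divg mb x) *\<^sub>R grad rb x
      + (\<nu> * q x / rb x) *\<^sub>R grad (divg mb) x)"

definition density_drift ::
    "real \<Rightarrow> (real ^ 'n \<Rightarrow> real ^ 'n) \<Rightarrow> (real ^ 'n \<Rightarrow> real) \<Rightarrow> (real ^ 'n \<Rightarrow> real) \<Rightarrow> real ^ 'n \<Rightarrow> real" where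
  "density_drift \<nu> mb rb q x =
     - divg (\<lambda>y. q y *\<^sub>R mean_velocity mb rb y + (\<nu> * q y) *\<^sub>R grad (\<lambda>z. ln (rb z)) y) x"

definition momentum_noise ::
    "real \<Rightarrow> (real ^ 'n \<Rightarrow> real ^ 'n) \<Rightarrow> (real ^ 'n \<Rightarrow> real ^ 'n) \<Rightarrow> real ^ 'n \<Rightarrow> real ^ 'n" where
  "momentum_noise \<epsilon> X m x = - (\<epsilon> *\<^sub>R ad_transpose X m x)"

definition density_noise ::
    "real \<Rightarrow> (real ^ 'n \<Rightarrow> real ^ 'n) \<Rightarrow> (real ^ 'n \<Rightarrow> real) \<Rightarrow> real ^ 'n \<Rightarrow> real" where
  "density_noise \<epsilon> X q x = - (\<epsilon> * divg (\<lambda>y. q y *\<^sub>R X y) x)"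

end

theory Submission
  imports Defs
begin

text \<open>Pulled back to the fixed loop \<open>c\<close> by the flow, the integrand of the circulation at a point of the
  loop is \<open>g(\<mu> \<circ> \<Phi>, \<rho> \<circ> \<Phi>, D\<Phi> h)\<close> with \<open>g(m, q, k) = (m \<bullet> k) / q\<close>. By the chain rule its noise coefficients
  cancel identically, because \<open>\<mu>\<close>, \<open>\<rho>\<close> and \<open>D\<Phi> h\<close> are all Lie transported along the divergence-free \<open>\<xi>\<^sub>r\<close>,
  and the transport parts of the drift cancel in the same way. The remaining forces, divided by \<open>\<rho>\<close>,
  form the gradient of the deterministic potential
  \<open>\<psi> = |u|\<^sup>2/2 - (U(\<rho>) + \<rho> U'(\<rho>)) + \<kappa> \<Delta>\<rho> + \<nu> div(\<mu>)/\<rho>\<close>, taken at the mean fields,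
  so that the drift is the exact form \<open>d(\<psi> \<circ> \<Phi>)\<close>, whose integral over the closed loop vanishes.
  The exceptional null sets depend on time and on the point of the loop; they are
  handled by restricting to rational parameters and using continuity.\<close>

section \<open>Differentiability classes\<close>

lemma Ck_on_cong:
  assumes "open S" "\<And>x. x \<in> S \<Longrightarrow> f x = g x" "Ck_on k S f"
  shows "Ck_on k S g"
  using assms
proof (induction k arbitrary: f g)
  case 0
  then show ?case
    using continuous_on_cong by force
next
  case (Suc k)
  have diff: "f differentiable (at x)" if "x \<in> S" for x
    using Suc.prems(3) that by simp
  have "g differentiable (at x)" if "x \<in> S" for x
    using diff[OF that] Suc.prems(1,2) that
    unfolding differentiable_def by (meson has_derivative_transform_within_open)
  moreover have "Ck_on k S (\<lambda>x. frechet_derivative g (at x) b)" if "b \<in> Basis" for b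
  proof (rule Suc.IH[OF Suc.prems(1)])
    show "Ck_on k S (\<lambda>x. frechet_derivative f (at x) b)"
      using Suc.prems(3) that by simp
    show "frechet_derivative f (at x) b = frechet_derivative g (at x) b" if "x \<in> S" for x
      using frechet_derivative_transform_within_open[OF diff[OF that] Suc.prems(1) that, of g] Suc.prems(2)
      by simp
  qed
  ultimately show ?case by simp
qed

lemma Ck_on_SucD: "Ck_on (Suc k) S f \<Longrightarrow> Ck_on k S f"
proof (induction k arbitrary: f)
  case 0
  then show ?case
    by (auto intro!: continuous_at_imp_continuous_on differentiable_imp_continuous_within)
next
  case (Suc k)
  then show ?case by (metis Ck_on.simps(2))
qed

lemma Ck_on_SucI:
  assumes "open S" "\<And>x. x \<in> S \<Longrightarrow> (f has_derivative f' x) (at x)"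
    and "\<And>b. b \<in> Basis \<Longrightarrow> Ck_on k S (\<lambda>x. f' x b)"
  shows "Ck_on (Suc k) S f"
proof -
  have "Ck_on k S (\<lambda>x. frechet_derivative f (at x) b)" if "b \<in> Basis" for b
    by (rule Ck_on_cong[OF assms(1) _ assms(3)[OF that]]) (metis assms(2) frechet_derivative_at)
  then show ?thesis
    by (auto intro: differentiableI assms(2))
qed

lemma Ck_on_const: "Ck_on k S (\<lambda>x. c)"
  by (induction k arbitrary: c) auto

lemma Ck_on_bounded_linear:
  assumes "bounded_linear f" "open S"
  shows "Ck_on k S f"
proof (cases k)
  case 0
  then show ?thesis
    using assms(1) linear_continuous_on by auto
next
  case (Suc k')
  then show ?thesis
    using Ck_on_SucI[OF assms(2), of f "\<lambda>_. f"] Ck_on_const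
      bounded_linear_imp_has_derivative[OF assms(1)] by auto
qed

lemma Ck_on_add:
  assumes "open S" "Ck_on k S f" "Ck_on k S g"
  shows "Ck_on k S (\<lambda>x. f x + g x)"
  using assms
proof (induction k arbitrary: f g)
  case 0
  then show ?case by (auto intro: continuous_on_add)
next
  case (Suc k)
  show ?case
  proof (rule Ck_on_SucI[OF Suc.prems(1)])
    show "((\<lambda>x. f x + g x) has_derivative
        (\<lambda>h. frechet_derivative f (at x) h + frechet_derivative g (at x) h)) (at x)" if "x \<in> S" for x
      using Suc.prems that by (auto intro!: has_derivative_add simp: frechet_derivative_works[symmetric])
  qed (use Suc in auto)
qed

lemma Ck_on_mult:
  fixes f g :: "'a::euclidean_space \<Rightarrow> real"
  assumes "open S" "Ck_on k S f" "Ck_on k S g"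
  shows "Ck_on k S (\<lambda>x. f x * g x)"
  using assms
proof (induction k arbitrary: f g)
  case 0
  then show ?case by (auto intro: continuous_on_mult)
next
  case (Suc k)
  show ?case
  proof (rule Ck_on_SucI[OF Suc.prems(1)])
    show "((\<lambda>x. f x * g x) has_derivative
        (\<lambda>h. f x * frechet_derivative g (at x) h + frechet_derivative f (at x) h * g x)) (at x)"
      if "x \<in> S" for x
      using Suc.prems that by (auto intro!: has_derivative_mult simp: frechet_derivative_works[symmetric])
    show "Ck_on k S (\<lambda>x. f x * frechet_derivative g (at x) b + frechet_derivative f (at x) b * g x)"
      if "b \<in> Basis" for b
      using Suc.prems that by (intro Ck_on_add Suc.IH) (auto intro: Ck_on_SucD)
  qed
qed

lemma Ck_on_inverse:
  fixes f :: "'a::euclidean_space \<Rightarrow> real"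
  assumes "open S" "Ck_on k S f" "\<And>x. x \<in> S \<Longrightarrow> f x \<noteq> 0"
  shows "Ck_on k S (\<lambda>x. inverse (f x))"
  using assms(2)
proof (induction k)
  case 0
  then show ?case using assms by (auto intro: continuous_on_inverse)
next
  case (Suc k)
  show ?case
  proof (rule Ck_on_SucI[OF assms(1)])
    show "((\<lambda>x. inverse (f x)) has_derivative
        (\<lambda>h. - 1 * (inverse (f x) * (frechet_derivative f (at x) h * inverse (f x))))) (at x)"
      if "x \<in> S" for x
      using Suc.prems that assms(3)[OF that]
      by (auto intro!: derivative_eq_intros simp: frechet_derivative_works[symmetric] fun_eq_iff)
    have "Ck_on k S (\<lambda>x. inverse (f x))"
      using Suc Ck_on_SucD by blast
    then show "Ck_on k S (\<lambda>x. - 1 * (inverse (f x) * (frechet_derivative f (at x) b * inverse (f x))))"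
      if "b \<in> Basis" for b
      using Suc.prems that assms(1) by (intro Ck_on_mult Ck_on_const) auto
  qed
qed

lemma Ck_on_sum:
  assumes "open S" "finite I" "\<And>i. i \<in> I \<Longrightarrow> Ck_on k S (f i)"
  shows "Ck_on k S (\<lambda>x. \<Sum>i\<in>I. f i x)"
  using assms(2,3)
  by (induction I) (auto intro: Ck_on_const Ck_on_add[OF assms(1)])

lemma smooth_on_inner_divide:
  "smooth_on {z::'a::euclidean_space \<times> real \<times> 'a. 0 < fst (snd z)}
     (\<lambda>z. (fst z \<bullet> snd (snd z)) / fst (snd z))" (is "smooth_on ?S ?g")
  unfolding smooth_on_def
proof
  fix k
  have S: "open ?S"
    by (intro open_Collect_less continuous_intros)
  have "Ck_on k ?S (\<lambda>z. (\<Sum>b\<in>Basis. (fst z \<bullet> b) * (snd (snd z) \<bullet> b)) * inverse (fst (snd z)))"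
    by (intro Ck_on_mult Ck_on_sum Ck_on_inverse S finite_Basis Ck_on_bounded_linear)
      (auto intro!: bounded_linear_intros bounded_linear_fst_comp bounded_linear_snd_comp)
  then show "Ck_on k ?S ?g"
    by (simp add: euclidean_inner[symmetric] divide_inverse)
qed

lemma frechet_derivative_inner_divide:
  fixes m k :: "'a::euclidean_space"
  assumes "0 < q"
  shows "frechet_derivative (\<lambda>z. (fst z \<bullet> snd (snd z)) / fst (snd z)) (at (m, q, k)) (dm, dq, dk)
    = (dm \<bullet> k + m \<bullet> dk) / q - (m \<bullet> k) * dq / q\<^sup>2"
proof -
  have "((\<lambda>z. (fst z \<bullet> snd (snd z)) / fst (snd z)) has_derivative
     (\<lambda>d. (fst d \<bullet> k + m \<bullet> snd (snd d)) / q - (m \<bullet> k) * fst (snd d) / q\<^sup>2)) (at (m, q, k))"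
    using assms by (auto intro!: derivative_eq_intros simp: fun_eq_iff power2_eq_square field_simps)
  from frechet_derivative_at[OF this, THEN fun_cong, of "(dm, dq, dk)"] show ?thesis
    by simp
qed


section \<open>Stratonovich differentials\<close>

lemma time_partition_mem:
  assumes "time_partition t N \<tau>" "i \<le> N"
  shows "\<tau> i \<in> {0..t}"
proof -
  have step: "\<tau> j \<le> \<tau> (Suc j)" if "j < N" for j
    using assms(1) that by (simp add: time_partition_def)
  have "0 \<le> \<tau> j" if "j \<le> N" for j
    using that
  proof (induction j)
    case 0
    then show ?case using assms(1) by (simp add: time_partition_def)
  next
    case (Suc j)
    then show ?case using step[of j] by simp
  qed
  moreover have "\<tau> i \<le> t"
    using assms(2)
  proof (induction rule: inc_induct)
    case base
    then show ?case using assms(1) by (simp add: time_partition_def)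
  next
    case (step j)
    then show ?case using \<open>\<And>j. j < N \<Longrightarrow> \<tau> j \<le> \<tau> (Suc j)\<close>[of j] by simp
  qed
  ultimately show ?thesis using assms(2) by simp
qed

lemma stratonovich_sum_measurable:
  assumes "\<And>t. subalgebra M (F t)" "adapted_on F t Y" "adapted_on F t B" "time_partition t N \<tau>"
  shows "stratonovich_sum N \<tau> Y B \<in> borel_measurable M"
proof -
  have "Y (\<tau> i) \<in> borel_measurable M" "B (\<tau> i) \<in> borel_measurable M" if "i \<le> N" for i
    using assms time_partition_mem[OF assms(4) that] measurable_from_subalg[OF assms(1)]
    unfolding adapted_on_def by blast+
  then show ?thesis
    unfolding stratonovich_sum_def
    by (intro borel_measurable_sum borel_measurable_scaleR borel_measurable_diff borel_measurable_add
        borel_measurable_const) auto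
qed

lemma stratonovich_sum_Pair:
  "stratonovich_sum N \<tau> (\<lambda>s \<omega>. (Y s \<omega>, Z s \<omega>)) B \<omega> =
     (stratonovich_sum N \<tau> Y B \<omega>, stratonovich_sum N \<tau> Z B \<omega>)"
  by (simp add: stratonovich_sum_def prod_eq_iff fst_sum snd_sum)

lemma has_stratonovich_integral_Pair:
  assumes "prob_space M" and sub: "\<And>t. subalgebra M (F t)"
    and J: "has_stratonovich_integral M F t Y B J"
    and K: "has_stratonovich_integral M F t Z B K"
  shows "has_stratonovich_integral M F t (\<lambda>s \<omega>. (Y s \<omega>, Z s \<omega>)) B (\<lambda>\<omega>. (J \<omega>, K \<omega>))"
  unfolding has_stratonovich_integral_def
proof (intro conjI allI impI)
  interpret prob_space M by fact
  show "adapted_on F t (\<lambda>s \<omega>. (Y s \<omega>, Z s \<omega>))" "adapted_on F t B"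
    using J K unfolding has_stratonovich_integral_def adapted_on_def
    by (auto intro: borel_measurable_Pair)
  have [measurable]: "J \<in> borel_measurable M" "K \<in> borel_measurable M"
    using J K by (auto simp: has_stratonovich_integral_def)
  show "(\<lambda>\<omega>. (J \<omega>, K \<omega>)) \<in> borel_measurable M" by measurable
  fix \<eta> p :: real
  assume pos: "0 < \<eta>" "0 < p"
  obtain \<delta>\<^sub>1 where d1: "\<delta>\<^sub>1 > 0" and J': "\<And>N \<tau>. time_partition t N \<tau> \<and> (\<forall>i<N. \<tau> (Suc i) - \<tau> i < \<delta>\<^sub>1) \<Longrightarrow>
        measure M {\<omega> \<in> space M. norm (stratonovich_sum N \<tau> Y B \<omega> - J \<omega>) > \<eta>/2} < p/2"
    using J[unfolded has_stratonovich_integral_def, THEN conjunct2, THEN conjunct2, THEN conjunct2,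
        rule_format, of "\<eta>/2" "p/2"] pos by auto
  obtain \<delta>\<^sub>2 where d2: "\<delta>\<^sub>2 > 0" and K': "\<And>N \<tau>. time_partition t N \<tau> \<and> (\<forall>i<N. \<tau> (Suc i) - \<tau> i < \<delta>\<^sub>2) \<Longrightarrow>
        measure M {\<omega> \<in> space M. norm (stratonovich_sum N \<tau> Z B \<omega> - K \<omega>) > \<eta>/2} < p/2"
    using K[unfolded has_stratonovich_integral_def, THEN conjunct2, THEN conjunct2, THEN conjunct2,
        rule_format, of "\<eta>/2" "p/2"] pos by auto
  show "\<exists>\<delta>>0. \<forall>N \<tau>. time_partition t N \<tau> \<and> (\<forall>i<N. \<tau> (Suc i) - \<tau> i < \<delta>) \<longrightarrow>
        measure M {\<omega> \<in> space M. norm (stratonovich_sum N \<tau> (\<lambda>s \<omega>. (Y s \<omega>, Z s \<omega>)) B \<omega> - (J \<omega>, K \<omega>)) > \<eta>} < p"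
  proof (intro exI[of _ "min \<delta>\<^sub>1 \<delta>\<^sub>2"] conjI allI impI)
    fix N \<tau>
    assume \<tau>: "time_partition t N \<tau> \<and> (\<forall>i<N. \<tau> (Suc i) - \<tau> i < min \<delta>\<^sub>1 \<delta>\<^sub>2)"
    have [measurable]: "stratonovich_sum N \<tau> Y B \<in> borel_measurable M"
       "stratonovich_sum N \<tau> Z B \<in> borel_measurable M"
      using J K \<tau> by (auto simp: has_stratonovich_integral_def intro!: stratonovich_sum_measurable[OF sub])
    let ?A = "{\<omega> \<in> space M. norm (stratonovich_sum N \<tau> Y B \<omega> - J \<omega>) > \<eta>/2}"
    let ?B = "{\<omega> \<in> space M. norm (stratonovich_sum N \<tau> Z B \<omega> - K \<omega>) > \<eta>/2}"
    have "measure M {\<omega> \<in> space M. norm (stratonovich_sum N \<tau> (\<lambda>s \<omega>. (Y s \<omega>, Z s \<omega>)) B \<omega> - (J \<omega>, K \<omega>)) > \<eta>}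
       \<le> measure M (?A \<union> ?B)"
    proof (rule finite_measure_mono)
      have "\<eta> < norm a + norm b" if "\<eta> < norm (a, b)" for a :: 'b and b :: 'c
        using that norm_Pair_le[of a b] by linarith
      then show "{\<omega> \<in> space M. norm (stratonovich_sum N \<tau> (\<lambda>s \<omega>. (Y s \<omega>, Z s \<omega>)) B \<omega> - (J \<omega>, K \<omega>)) > \<eta>} \<subseteq> ?A \<union> ?B"
        unfolding stratonovich_sum_Pair by (fastforce simp: not_less)
    qed measurable
    also have "\<dots> \<le> measure M ?A + measure M ?B"
      by (rule measure_Un_le) measurable
    also have "\<dots> < p/2 + p/2"
      using \<tau> by (intro add_strict_mono J' K') auto
    finally show "measure M {\<omega> \<in> space M. norm (stratonovich_sum N \<tau> (\<lambda>s \<omega>. (Y s \<omega>, Z s \<omega>)) B \<omega> - (J \<omega>, K \<omega>)) > \<eta>} < p"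
      by simp
  qed (use d1 d2 in auto)
qed

lemma set_integral_Pair:
  fixes f :: "'a \<Rightarrow> 'b::{banach, second_countable_topology}" and g :: "'a \<Rightarrow> 'c::{banach, second_countable_topology}"
  assumes "set_integrable N A f" "set_integrable N A g"
  shows "set_integrable N A (\<lambda>x. (f x, g x))"
    and "(LINT x:A|N. (f x, g x)) = ((LINT x:A|N. f x), (LINT x:A|N. g x))"
proof -
  have 1: "bounded_linear (\<lambda>x::'b. (x, 0::'c))" and 2: "bounded_linear (\<lambda>x::'c. (0::'b, x))"
    by (auto intro!: bounded_linear_Pair bounded_linear_ident bounded_linear_zero)
  have eq: "(indicator A x :: real) *\<^sub>R (f x, g x) =
      (indicator A x *\<^sub>R f x, 0) + (0, indicator A x *\<^sub>R g x)" for x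
    by simp
  note i = integrable_bounded_linear[OF 1 assms(1)[unfolded set_integrable_def]]
    integrable_bounded_linear[OF 2 assms(2)[unfolded set_integrable_def]]
  show "set_integrable N A (\<lambda>x. (f x, g x))"
    unfolding set_integrable_def eq by (intro Bochner_Integration.integrable_add i)
  show "(LINT x:A|N. (f x, g x)) = ((LINT x:A|N. f x), (LINT x:A|N. g x))"
    unfolding set_lebesgue_integral_def eq
    using integral_bounded_linear[OF 1 assms(1)[unfolded set_integrable_def]]
      integral_bounded_linear[OF 2 assms(2)[unfolded set_integrable_def]]
    by (subst Bochner_Integration.integral_add[OF i]) simp
qed

lemma has_stratonovich_differential_Pair:
  assumes "prob_space M" "\<And>t. subalgebra M (F t)"
    and X: "has_stratonovich_differential M F R W T X a b"
    and Y: "has_stratonovich_differential M F R W T Y a' b'"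
  shows "has_stratonovich_differential M F R W T
    (\<lambda>t \<omega>. (X t \<omega>, Y t \<omega>)) (\<lambda>t \<omega>. (a t \<omega>, a' t \<omega>)) (\<lambda>r t \<omega>. (b r t \<omega>, b' r t \<omega>))"
  unfolding has_stratonovich_differential_def
proof (intro ballI conjI)
  fix t assume t: "t \<in> {0..T}"
  obtain J where J: "\<And>r. r \<in> R \<Longrightarrow> has_stratonovich_integral M F t (b r) (W r) (J r)"
    and XJ: "AE \<omega> in M. X t \<omega> = X 0 \<omega> + (LINT s:{0..t}|lborel. a s \<omega>) + (\<Sum>r\<in>R. J r \<omega>)"
    and Xi: "AE \<omega> in M. set_integrable lborel {0..t} (\<lambda>s. a s \<omega>)"
    using X t unfolding has_stratonovich_differential_def by blast
  obtain K where K: "\<And>r. r \<in> R \<Longrightarrow> has_stratonovich_integral M F t (b' r) (W r) (K r)"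
    and YK: "AE \<omega> in M. Y t \<omega> = Y 0 \<omega> + (LINT s:{0..t}|lborel. a' s \<omega>) + (\<Sum>r\<in>R. K r \<omega>)"
    and Yi: "AE \<omega> in M. set_integrable lborel {0..t} (\<lambda>s. a' s \<omega>)"
    using Y t unfolding has_stratonovich_differential_def by blast
  show "AE \<omega> in M. set_integrable lborel {0..t} (\<lambda>s. (a s \<omega>, a' s \<omega>))"
    using Xi Yi by eventually_elim (rule set_integral_Pair)
  show "\<exists>J. (\<forall>r\<in>R. has_stratonovich_integral M F t (\<lambda>t \<omega>. (b r t \<omega>, b' r t \<omega>)) (W r) (J r)) \<and>
      (AE \<omega> in M. (X t \<omega>, Y t \<omega>) = (X 0 \<omega>, Y 0 \<omega>) + (LINT s:{0..t}|lborel. (a s \<omega>, a' s \<omega>)) + (\<Sum>r\<in>R. J r \<omega>))"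
  proof (intro exI[of _ "\<lambda>r \<omega>. (J r \<omega>, K r \<omega>)"] conjI ballI)
    show "has_stratonovich_integral M F t (\<lambda>t \<omega>. (b r t \<omega>, b' r t \<omega>)) (W r) (\<lambda>\<omega>. (J r \<omega>, K r \<omega>))"
      if "r \<in> R" for r
      using has_stratonovich_integral_Pair[OF assms(1,2) J[OF that] K[OF that]] .
    show "AE \<omega> in M. (X t \<omega>, Y t \<omega>) = (X 0 \<omega>, Y 0 \<omega>) + (LINT s:{0..t}|lborel. (a s \<omega>, a' s \<omega>)) + (\<Sum>r\<in>R. (J r \<omega>, K r \<omega>))"
      using XJ YK Xi Yi
      by eventually_elim (simp add: set_integral_Pair prod_eq_iff fst_sum snd_sum)
  qed
qed

lemma fine_time_partition:
  assumes "0 \<le> t" "0 < \<delta>"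
  obtains N \<tau> where "time_partition t N \<tau>" "\<forall>i<N. \<tau> (Suc i) - \<tau> i < \<delta>"
proof -
  obtain N :: nat where N: "t / \<delta> < real N"
    using reals_Archimedean2 by blast
  then have "0 < N"
    using assms by (metis divide_nonneg_pos gr0I linorder_not_less of_nat_0)
  have step: "t * real (Suc i) / N - t * real i / N = t / N" for i
    by (simp add: diff_divide_distrib[symmetric] algebra_simps)
  have "time_partition t N (\<lambda>i. t * i / N)"
    using \<open>0 < N\<close> assms(1) unfolding time_partition_def by (auto intro!: divide_right_mono mult_left_mono)
  moreover have "t / N < \<delta>"
    using N \<open>0 < N\<close> assms(2) by (simp add: field_simps)
  ultimately show thesis
    using that step by metis
qed

lemma stratonovich_integral_zero_AE:
  assumes "prob_space M" "0 \<le> t" and J: "has_stratonovich_integral M F t Y B J"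
    and zero: "\<And>s \<omega>. s \<in> {0..t} \<Longrightarrow> \<omega> \<in> space M \<Longrightarrow> Y s \<omega> = 0"
  shows "AE \<omega> in M. J \<omega> = 0"
proof -
  interpret prob_space M by fact
  have [measurable]: "J \<in> borel_measurable M"
    using J by (simp add: has_stratonovich_integral_def)
  have null: "measure M {\<omega> \<in> space M. norm (J \<omega>) > \<eta>} = 0" if "0 < \<eta>" for \<eta>
  proof (rule ccontr)
    assume "measure M {\<omega> \<in> space M. norm (J \<omega>) > \<eta>} \<noteq> 0"
    then have "0 < measure M {\<omega> \<in> space M. norm (J \<omega>) > \<eta>}"
      by (simp add: zero_less_measure_iff)
    then obtain \<delta> where "\<delta> > 0" and \<delta>: "\<And>N \<tau>. time_partition t N \<tau> \<and> (\<forall>i<N. \<tau> (Suc i) - \<tau> i < \<delta>) \<Longrightarrow>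
        measure M {\<omega> \<in> space M. norm (stratonovich_sum N \<tau> Y B \<omega> - J \<omega>) > \<eta>}
          < measure M {\<omega> \<in> space M. norm (J \<omega>) > \<eta>}"
      using J \<open>0 < \<eta>\<close> unfolding has_stratonovich_integral_def by meson
    obtain N \<tau> where \<tau>: "time_partition t N \<tau>" "\<forall>i<N. \<tau> (Suc i) - \<tau> i < \<delta>"
      using fine_time_partition[OF assms(2) \<open>\<delta> > 0\<close>] .
    have "stratonovich_sum N \<tau> Y B \<omega> = 0" if "\<omega> \<in> space M" for \<omega>
      unfolding stratonovich_sum_def
      using that zero time_partition_mem[OF \<tau>(1)] by (intro sum.neutral) (simp add: Suc_leI)
    then have "{\<omega> \<in> space M. norm (stratonovich_sum N \<tau> Y B \<omega> - J \<omega>) > \<eta>} = {\<omega> \<in> space M. norm (J \<omega>) > \<eta>}"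
      by auto
    then show False using \<delta>[of N \<tau>] \<tau> by auto
  qed
  have "AE \<omega> in M. \<forall>n::nat. norm (J \<omega>) \<le> 1 / Suc n"
    unfolding AE_all_countable
  proof
    fix n :: nat
    show "AE \<omega> in M. norm (J \<omega>) \<le> 1 / Suc n"
      by (rule AE_I[of _ _ "{\<omega> \<in> space M. norm (J \<omega>) > 1 / Suc n}"])
        (auto simp: not_le null emeasure_eq_measure)
  qed
  then show ?thesis
  proof eventually_elim
    case (elim \<omega>)
    show ?case
    proof (rule ccontr)
      assume "J \<omega> \<noteq> 0"
      then obtain n where "inverse (real (Suc n)) < norm (J \<omega>)"
        using reals_Archimedean zero_less_norm_iff by blast
      then show False using elim[rule_format, of n] by (simp add: inverse_eq_divide)
    qed
  qed
qed

lemma has_stratonovich_integral_zero: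
  assumes "adapted_on F t B"
  shows "has_stratonovich_integral M F t (\<lambda>s \<omega>. 0) B (\<lambda>\<omega>. 0)"
  using assms
  by (auto simp: has_stratonovich_integral_def adapted_on_def stratonovich_sum_def intro!: exI[of _ 1])

lemma has_stratonovich_differential_constant:
  assumes "independent_brownian_motions M F R W"
    and "AE \<omega> in M. \<forall>t\<in>{0..T}. X t \<omega> = X 0 \<omega>"
  shows "has_stratonovich_differential M F R W T X (\<lambda>t \<omega>. 0) (\<lambda>r t \<omega>. 0)"
  unfolding has_stratonovich_differential_def
proof (intro ballI conjI)
  fix t assume t: "t \<in> {0..T}"
  have "adapted_on F t (W r)" if "r \<in> R" for r
    using assms(1) that
    by (auto simp: independent_brownian_motions_def brownian_motion_def adapted_on_def)
  moreover have "AE \<omega> in M. X t \<omega> = X 0 \<omega> + (LINT s:{0..t}|lborel. 0) + (\<Sum>r\<in>R. 0)"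
    using assms(2)
  proof eventually_elim
    case (elim \<omega>)
    from bspec[OF elim t] show ?case by (simp add: set_lebesgue_integral_def)
  qed
  ultimately show "\<exists>J. (\<forall>r\<in>R. has_stratonovich_integral M F t (\<lambda>t \<omega>. 0) (W r) (J r)) \<and>
     (AE \<omega> in M. X t \<omega> = X 0 \<omega> + (LINT s:{0..t}|lborel. 0) + (\<Sum>r\<in>R. J r \<omega>))"
    by (intro exI[of _ "\<lambda>r \<omega>. 0"] conjI ballI has_stratonovich_integral_zero)
qed (simp add: set_integrable_def)

lemma noiseless_differential_AE:
  assumes M: "prob_space M" and R: "finite R"
    and X: "has_stratonovich_differential M F R W T X a b"
    and a: "\<And>s \<omega>. s \<in> {0..T} \<Longrightarrow> \<omega> \<in> space M \<Longrightarrow> a s \<omega> = a' s \<omega>"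
    and b: "\<And>r s \<omega>. r \<in> R \<Longrightarrow> s \<in> {0..T} \<Longrightarrow> \<omega> \<in> space M \<Longrightarrow> b r s \<omega> = 0"
    and t: "t \<in> {0..T}"
  shows "AE \<omega> in M. X t \<omega> = X 0 \<omega> + integral {0..t} (\<lambda>s. a' s \<omega>)"
proof -
  obtain J where J: "\<And>r. r \<in> R \<Longrightarrow> has_stratonovich_integral M F t (b r) (W r) (J r)"
    and XJ: "AE \<omega> in M. X t \<omega> = X 0 \<omega> + (LINT s:{0..t}|lborel. a s \<omega>) + (\<Sum>r\<in>R. J r \<omega>)"
    and int: "AE \<omega> in M. set_integrable lborel {0..t} (\<lambda>s. a s \<omega>)"
    using X t unfolding has_stratonovich_differential_def by blast
  have "AE \<omega> in M. \<forall>r\<in>R. J r \<omega> = 0"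
  proof (rule AE_ball_countable'[OF _ countable_finite[OF R]])
    show "AE \<omega> in M. J r \<omega> = 0" if "r \<in> R" for r
      by (rule stratonovich_integral_zero_AE[OF M _ J[OF that]]) (use t b[OF that] in auto)
  qed
  with XJ int AE_space show ?thesis
  proof eventually_elim
    case (elim \<omega>)
    have "(LINT s:{0..t}|lborel. a s \<omega>) = integral {0..t} (\<lambda>s. a s \<omega>)"
      using elim(2) by (rule set_borel_integral_eq_integral)
    also have "\<dots> = integral {0..t} (\<lambda>s. a' s \<omega>)"
      by (rule Henstock_Kurzweil_Integration.integral_cong) (use a elim(3) t in auto)
    finally show ?case
      using elim(1,4) by simp
  qed
qed

section \<open>Vector calculus\<close>

lemma differentiable_vec_nth:
  "X differentiable (at x) \<Longrightarrow> (\<lambda>y. X y $ j) differentiable (at x)"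
  unfolding differentiable_def
  by (blast intro: bounded_linear.has_derivative[OF bounded_linear_vec_nth])

lemma differentiable_vec_lambda:
  fixes X :: "'a::euclidean_space \<Rightarrow> real ^ 'n"
  assumes "\<And>j. (\<lambda>y. X y $ j) differentiable (at x)"
  shows "X differentiable (at x)"
  using assms by (subst differentiable_componentwise_within) (auto simp: Basis_vec_def inner_axis)

lemma partial_d_vec_nth:
  assumes "X differentiable (at x)"
  shows "partial_d i (\<lambda>y. X y $ j) x = frechet_derivative X (at x) (axis i 1) $ j"
  unfolding partial_d_def
  using assms frechet_derivative_at[OF bounded_linear.has_derivative[OF bounded_linear_vec_nth]]
  by (metis frechet_derivative_works)

lemma linear_axis_expansion:
  fixes L :: "real ^ 'n \<Rightarrow> 'b::real_vector"
  assumes "linear L"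
  shows "L h = (\<Sum>i\<in>UNIV. h $ i *\<^sub>R L (axis i 1))"
proof -
  have "L (\<Sum>i\<in>UNIV. h $ i *\<^sub>R axis i 1) = (\<Sum>i\<in>UNIV. h $ i *\<^sub>R L (axis i 1))"
    by (simp add: linear_sum[OF assms] linear_scale[OF assms])
  moreover have "(\<Sum>i\<in>UNIV. h $ i *\<^sub>R axis i 1) = h"
    by (simp add: vec_eq_iff axis_def if_distrib cong: if_cong)
  ultimately show ?thesis by simp
qed

lemma grad_inner:
  assumes "f differentiable (at x)"
  shows "grad f x \<bullet> h = frechet_derivative f (at x) h"
  using linear_axis_expansion[OF linear_frechet_derivative[OF assms], of h]
  by (simp add: grad_def partial_d_def inner_vec_def mult.commute)

lemma has_derivative_grad:
  assumes "f differentiable (at x)"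
  shows "(f has_derivative (\<lambda>h. grad f x \<bullet> h)) (at x)"
  using assms by (simp add: grad_inner frechet_derivative_works[symmetric] eta_contract_eq)

lemma grad_eqI:
  assumes "(f has_derivative (\<lambda>h. g \<bullet> h)) (at x)"
  shows "grad f x = g"
proof -
  have "grad f x \<bullet> h = g \<bullet> h" for h
    using assms grad_inner frechet_derivative_at differentiableI by metis
  then show ?thesis using vector_eq_rdot by blast
qed

lemma nabla_eq_frechet_derivative:
  assumes "Y differentiable (at x)"
  shows "nabla X Y x = frechet_derivative Y (at x) (X x)"
  using linear_axis_expansion[OF linear_frechet_derivative[OF assms], of "X x"]
  by (simp add: nabla_def vec_eq_iff partial_d_vec_nth[OF assms])

lemma nabla_transpose_inner:
  assumes "X differentiable (at x)"
  shows "nabla_transpose X Y x \<bullet> h = Y x \<bullet> frechet_derivative X (at x) h"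
proof -
  have "frechet_derivative X (at x) h $ j = (\<Sum>i\<in>UNIV. h $ i * partial_d i (\<lambda>y. X y $ j) x)" for j
    by (subst linear_axis_expansion[OF linear_frechet_derivative[OF assms]])
      (simp add: partial_d_vec_nth[OF assms])
  then show ?thesis
    unfolding nabla_transpose_def inner_vec_def
    by (simp add: sum_distrib_left sum_distrib_right mult_ac, subst sum.swap) (rule refl)
qed

lemma nabla_transpose_add_scaleR:
  assumes "X differentiable (at x)" "Z differentiable (at x)"
  shows "nabla_transpose (\<lambda>y. X y + a *\<^sub>R Z y) Y x = nabla_transpose X Y x + a *\<^sub>R nabla_transpose Z Y x"
proof -
  have d: "((\<lambda>y. X y + a *\<^sub>R Z y) has_derivative
      (\<lambda>h. frechet_derivative X (at x) h + a *\<^sub>R frechet_derivative Z (at x) h)) (at x)"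
    using assms by (intro derivative_intros) (auto simp: frechet_derivative_works[symmetric])
  have "nabla_transpose (\<lambda>y. X y + a *\<^sub>R Z y) Y x \<bullet> h =
      (nabla_transpose X Y x + a *\<^sub>R nabla_transpose Z Y x) \<bullet> h" for h
    unfolding nabla_transpose_inner[OF differentiableI[OF d]] frechet_derivative_at[OF d, symmetric]
    by (simp add: nabla_transpose_inner[OF assms(1)] nabla_transpose_inner[OF assms(2)]
        inner_add_left inner_add_right)
  then show ?thesis using vector_eq_rdot by blast
qed

lemma divg_scaleR:
  assumes "q differentiable (at x)" "X differentiable (at x)"
  shows "divg (\<lambda>y. q y *\<^sub>R X y) x = q x * divg X x + grad q x \<bullet> X x"
proof -
  have "partial_d i (\<lambda>y. (q y *\<^sub>R X y) $ i) x = q x * partial_d i (\<lambda>y. X y $ i) x + grad q x $ i * X x $ i" for i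
  proof -
    have "((\<lambda>y. (q y *\<^sub>R X y) $ i) has_derivative
       (\<lambda>h. q x * frechet_derivative (\<lambda>y. X y $ i) (at x) h + frechet_derivative q (at x) h * X x $ i)) (at x)"
      using assms differentiable_vec_nth[OF assms(2), of i]
      by (auto intro!: has_derivative_mult simp: frechet_derivative_works[symmetric])
    from frechet_derivative_at[OF this, THEN fun_cong, of "axis i 1"] show ?thesis
      by (simp add: partial_d_def grad_def)
  qed
  then show ?thesis
    unfolding divg_def inner_vec_def by (simp add: sum.distrib sum_distrib_left)
qed

lemma material_derivative_momentum_noise:
  assumes "X differentiable (at x)" "m differentiable (at x)" "divg X x = 0"
  shows "material_derivative m (momentum_noise \<epsilon> X m) (\<lambda>y. \<epsilon> *\<^sub>R X y) x = - (\<epsilon> *\<^sub>R nabla_transpose X m x)"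
  using assms
  by (simp add: material_derivative_def momentum_noise_def ad_transpose_def nabla_eq_frechet_derivative
      linear_scale[OF linear_frechet_derivative] scaleR_add_right)

lemma material_derivative_density_noise:
  assumes "X differentiable (at x)" "q differentiable (at x)" "divg X x = 0"
  shows "material_derivative q (density_noise \<epsilon> X q) (\<lambda>y. \<epsilon> *\<^sub>R X y) x = 0"
  using assms
  by (simp add: material_derivative_def density_noise_def divg_scaleR
      linear_scale[OF linear_frechet_derivative] grad_inner)

lemma material_derivative_density_drift:
  fixes mb :: "real ^ 'n \<Rightarrow> real ^ 'n"
  assumes "transport_velocity \<nu> mb rb differentiable (at x)" "q differentiable (at x)"
  shows "material_derivative q (density_drift \<nu> mb rb q) (transport_velocity \<nu> mb rb) x =
    - (q x * divg (transport_velocity \<nu> mb rb) x)"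
proof -
  have eq: "(\<lambda>y. q y *\<^sub>R mean_velocity mb rb y + (\<nu> * q y) *\<^sub>R grad (\<lambda>z. ln (rb z)) y)
    = (\<lambda>y. q y *\<^sub>R transport_velocity \<nu> mb rb y)"
    by (simp add: transport_velocity_def scaleR_add_right mult.commute)
  show ?thesis
    unfolding material_derivative_def density_drift_def eq
    using assms by (simp add: divg_scaleR grad_inner)
qed

definition bernoulli_potential ::
    "(real \<Rightarrow> real) \<Rightarrow> real \<Rightarrow> real \<Rightarrow> (real ^ 'n \<Rightarrow> real ^ 'n) \<Rightarrow> (real ^ 'n \<Rightarrow> real) \<Rightarrow> real ^ 'n \<Rightarrow> real" where
  "bernoulli_potential U \<kappa> \<nu> mb rb x =
     (mean_velocity mb rb x \<bullet> mean_velocity mb rb x) / 2 - (rb x * deriv U (rb x) + U (rb x))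
     + \<kappa> * laplacian rb x + \<nu> * (divg mb x / rb x)"

lemma grad_bernoulli_potential:
  fixes mb :: "real ^ 'n \<Rightarrow> real ^ 'n"
  assumes u: "mean_velocity mb rb differentiable (at x)"
    and div: "divg mb differentiable (at x)"
    and rb: "rb differentiable (at x)" "0 < rb x"
    and lap: "laplacian rb differentiable (at x)"
    and U: "U differentiable (at (rb x))" "deriv U differentiable (at (rb x))"
  shows "(bernoulli_potential U \<kappa> \<nu> mb rb has_derivative (\<lambda>h. grad (bernoulli_potential U \<kappa> \<nu> mb rb) x \<bullet> h)) (at x)"
    and "grad (bernoulli_potential U \<kappa> \<nu> mb rb) x =
      nabla_transpose (mean_velocity mb rb) (mean_velocity mb rb) x
      - (1 / rb x) *\<^sub>R grad (\<lambda>y. (rb y)\<^sup>2 * deriv U (rb y)) x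
      + \<kappa> *\<^sub>R grad (laplacian rb) x
      - (\<nu> / (rb x)\<^sup>2 * divg mb x) *\<^sub>R grad rb x
      + (\<nu> / rb x) *\<^sub>R grad (divg mb) x" (is "?g = ?F")
proof -
  let ?u = "mean_velocity mb rb" and ?D = "frechet_derivative (mean_velocity mb rb) (at x)"
  let ?U' = "deriv U (rb x)" and ?U'' = "deriv (deriv U) (rb x)"
  have "((\<lambda>y. (1 / 2) * (?u y \<bullet> ?u y)) has_derivative (\<lambda>h. (1 / 2) * (?u x \<bullet> ?D h + ?D h \<bullet> ?u x))) (at x)"
    using u by (intro has_derivative_mult_right has_derivative_inner)
      (simp_all add: frechet_derivative_works[symmetric])
  then have d_u: "((\<lambda>y. (?u y \<bullet> ?u y) / 2) has_derivative (\<lambda>h. nabla_transpose ?u ?u x \<bullet> h)) (at x)"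
    by (simp add: nabla_transpose_inner[OF u] inner_commute[of "?D _"])
  note d_rb = has_derivative_grad[OF rb(1)]
  have "(U has_real_derivative ?U') (at (rb x))" "(deriv U has_real_derivative ?U'') (at (rb x))"
    using U by (simp_all add: DERIV_deriv_iff_real_differentiable)
  then have d_U: "((\<lambda>y. U (rb y)) has_derivative (\<lambda>h. ?U' * (grad rb x \<bullet> h))) (at x)"
    and d_U': "((\<lambda>y. deriv U (rb y)) has_derivative (\<lambda>h. ?U'' * (grad rb x \<bullet> h))) (at x)"
    using has_derivative_compose[OF d_rb] unfolding has_field_derivative_def by auto
  have g: "grad (\<lambda>y. (rb y)\<^sup>2 * deriv U (rb y)) x = (2 * rb x * ?U' + (rb x)\<^sup>2 * ?U'') *\<^sub>R grad rb x"
    by (rule grad_eqI) (auto intro!: derivative_eq_intros d_rb d_U' simp: algebra_simps)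
  have "((\<lambda>y. (?u y \<bullet> ?u y) / 2 - (rb y * deriv U (rb y) + U (rb y))
       + \<kappa> * laplacian rb y + \<nu> * (divg mb y / rb y)) has_derivative
     (\<lambda>h. nabla_transpose ?u ?u x \<bullet> h
       - ((rb x * (?U'' * (grad rb x \<bullet> h)) + (grad rb x \<bullet> h) * ?U') + ?U' * (grad rb x \<bullet> h))
       + \<kappa> * (grad (laplacian rb) x \<bullet> h)
       + \<nu> * (((grad (divg mb) x \<bullet> h) * rb x - divg mb x * (grad rb x \<bullet> h)) / (rb x * rb x)))) (at x)"
    using rb(2)
    by (intro has_derivative_add has_derivative_diff has_derivative_mult has_derivative_mult_right
        has_derivative_divide' has_derivative_divide d_u d_rb d_U d_U'
        has_derivative_grad[OF lap] has_derivative_grad[OF div]) auto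
  also have "(\<lambda>h. nabla_transpose ?u ?u x \<bullet> h
       - ((rb x * (?U'' * (grad rb x \<bullet> h)) + (grad rb x \<bullet> h) * ?U') + ?U' * (grad rb x \<bullet> h))
       + \<kappa> * (grad (laplacian rb) x \<bullet> h)
       + \<nu> * (((grad (divg mb) x \<bullet> h) * rb x - divg mb x * (grad rb x \<bullet> h)) / (rb x * rb x))) = (\<lambda>h. ?F \<bullet> h)"
    using rb(2) unfolding g
    by (simp add: fun_eq_iff inner_add_left inner_diff_left field_simps power2_eq_square)
  finally have d: "(bernoulli_potential U \<kappa> \<nu> mb rb has_derivative (\<lambda>h. ?F \<bullet> h)) (at x)"
    by (simp add: bernoulli_potential_def[abs_def])
  then show "?g = ?F" by (rule grad_eqI)
  then show "(bernoulli_potential U \<kappa> \<nu> mb rb has_derivative (\<lambda>h. ?g \<bullet> h)) (at x)"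
    using d by simp
qed

lemma material_derivative_momentum_drift:
  fixes mb :: "real ^ 'n \<Rightarrow> real ^ 'n"
  assumes u: "mean_velocity mb rb differentiable (at x)"
    and ln_rb: "grad (\<lambda>y. ln (rb y)) differentiable (at x)"
    and div: "divg mb differentiable (at x)"
    and rb: "rb differentiable (at x)" "0 < rb x"
    and lap: "laplacian rb differentiable (at x)"
    and U: "U differentiable (at (rb x))" "deriv U differentiable (at (rb x))"
    and m: "m differentiable (at x)"
  shows "material_derivative m (momentum_drift U \<kappa> \<nu> mb rb m q) (transport_velocity \<nu> mb rb) x =
    - (divg (transport_velocity \<nu> mb rb) x *\<^sub>R m x) - nabla_transpose (transport_velocity \<nu> mb rb) m x
    + q x *\<^sub>R grad (bernoulli_potential U \<kappa> \<nu> mb rb) x"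
proof -
  have "nabla_transpose (transport_velocity \<nu> mb rb) m x =
      nabla_transpose (mean_velocity mb rb) m x + \<nu> *\<^sub>R nabla_transpose (grad (\<lambda>y. ln (rb y))) m x"
    unfolding transport_velocity_def[abs_def]
    by (rule nabla_transpose_add_scaleR[OF u ln_rb])
  then show ?thesis
    unfolding material_derivative_def momentum_drift_def Let_def
      grad_bernoulli_potential(2)[OF u div rb lap U]
    by (simp add: nabla_eq_frechet_derivative[OF m] scaleR_add_right scaleR_diff_right mult_ac)
qed

lemma frechet_derivative_scaleR_compose:
  assumes "X differentiable (at (\<phi> x))" "\<phi> differentiable (at x)"
  shows "frechet_derivative (\<lambda>y. a *\<^sub>R X (\<phi> y)) (at x) h =
    a *\<^sub>R frechet_derivative X (at (\<phi> x)) (frechet_derivative \<phi> (at x) h)"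
proof -
  have "((\<lambda>y. a *\<^sub>R X (\<phi> y)) has_derivative
      (\<lambda>h. a *\<^sub>R frechet_derivative X (at (\<phi> x)) (frechet_derivative \<phi> (at x) h))) (at x)"
    using assms by (intro has_derivative_scaleR_right has_derivative_compose[of \<phi> _ _ _ X])
      (simp_all add: frechet_derivative_works[symmetric])
  from frechet_derivative_at[OF this, THEN fun_cong, of h] show ?thesis by simp
qed

lemma differentiable_divide_scaleR:
  fixes f :: "'a::real_normed_vector \<Rightarrow> real"
  assumes "f differentiable (at x)" "f x \<noteq> 0" "X differentiable (at x)"
  shows "(\<lambda>y. (1 / f y) *\<^sub>R X y) differentiable (at x)"
  using assms by (intro differentiable_scaleR differentiable_divide differentiable_const)

lemma grad_ln:
  assumes "f differentiable (at x)" "0 < f x"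
  shows "grad (\<lambda>y. ln (f y)) x = (1 / f x) *\<^sub>R grad f x"
  by (rule grad_eqI)
    (use assms in \<open>auto intro!: derivative_eq_intros has_derivative_grad[OF assms(1)] simp: divide_inverse\<close>)

lemma circulation_density_noise_cancels:
  fixes X m :: "real ^ 'n \<Rightarrow> real ^ 'n"
  assumes "X differentiable (at y)" "m differentiable (at y)" "q differentiable (at y)" "divg X y = 0" "0 < q y"
  shows "frechet_derivative (\<lambda>z. (fst z \<bullet> snd (snd z)) / fst (snd z)) (at (m y, q y, k))
    (material_derivative m (momentum_noise \<epsilon> X m) (\<lambda>y. \<epsilon> *\<^sub>R X y) y,
     material_derivative q (density_noise \<epsilon> X q) (\<lambda>y. \<epsilon> *\<^sub>R X y) y,
     \<epsilon> *\<^sub>R frechet_derivative X (at y) k) = 0"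
  using assms
  by (simp add: frechet_derivative_inner_divide material_derivative_momentum_noise
      material_derivative_density_noise nabla_transpose_inner)

lemma circulation_density_drift:
  fixes mb m :: "real ^ 'n \<Rightarrow> real ^ 'n"
  assumes u: "mean_velocity mb rb differentiable (at y)"
    and ln_rb: "grad (\<lambda>z. ln (rb z)) differentiable (at y)"
    and div: "divg mb differentiable (at y)"
    and rb: "rb differentiable (at y)" "0 < rb y"
    and lap: "laplacian rb differentiable (at y)"
    and U: "U differentiable (at (rb y))" "deriv U differentiable (at (rb y))"
    and m: "m differentiable (at y)" and q: "q differentiable (at y)" "0 < q y"
  shows "frechet_derivative (\<lambda>z. (fst z \<bullet> snd (snd z)) / fst (snd z)) (at (m y, q y, k))
    (material_derivative m (momentum_drift U \<kappa> \<nu> mb rb m q) (transport_velocity \<nu> mb rb) y,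
     material_derivative q (density_drift \<nu> mb rb q) (transport_velocity \<nu> mb rb) y,
     frechet_derivative (transport_velocity \<nu> mb rb) (at y) k) =
    grad (bernoulli_potential U \<kappa> \<nu> mb rb) y \<bullet> k"
proof -
  have v: "transport_velocity \<nu> mb rb differentiable (at y)"
    unfolding transport_velocity_def[abs_def]
    by (intro differentiable_add differentiable_scaleR differentiable_const u ln_rb)
  show ?thesis
    unfolding frechet_derivative_inner_divide[OF q(2)]
      material_derivative_momentum_drift[OF u ln_rb div rb lap U m]
      material_derivative_density_drift[OF v q(1)]
    using q(2)
    by (simp add: inner_add_left inner_diff_left nabla_transpose_inner[OF v] field_simps power2_eq_square)
qed

lemma int_lattice_uminus: "k \<in> int_lattice \<Longrightarrow> - k \<in> int_lattice"
  by (simp add: int_lattice_def)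

lemma periodic_frechet_derivative:
  assumes "periodic f" "k \<in> int_lattice"
  shows "frechet_derivative f (at (x + k)) = frechet_derivative f (at x)"
proof -
  have shift: "(f has_derivative D) (at y)" if "(f has_derivative D) (at (y + l))" "l \<in> int_lattice" for D y l
  proof -
    have "((\<lambda>z. z + l) has_derivative (\<lambda>h. h)) (at y)"
      by (auto intro!: derivative_eq_intros)
    from has_derivative_compose[OF this, of f D] that assms(1) show ?thesis
      by (simp add: periodic_def)
  qed
  have "(f has_derivative D) (at (x + k)) \<longleftrightarrow> (f has_derivative D) (at x)" for D
    using shift[of D x k] shift[of D "x + k" "- k"] assms(2) int_lattice_uminus[OF assms(2)] by auto
  then show ?thesis
    by (simp add: frechet_derivative_def)
qed

lemma periodic_partial_d: "periodic f \<Longrightarrow> periodic (partial_d i f)"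
  by (simp add: periodic_def[of "partial_d i f"] partial_d_def periodic_frechet_derivative)

lemma periodic_divg:
  assumes "periodic X"
  shows "periodic (divg X)"
proof -
  have "periodic (partial_d i (\<lambda>y. X y $ i))" for i
    using assms by (intro periodic_partial_d) (simp add: periodic_def)
  then show ?thesis by (simp add: periodic_def divg_def)
qed

lemma periodic_laplacian: "periodic f \<Longrightarrow> periodic (laplacian f)"
  unfolding laplacian_def
  by (intro periodic_divg) (use periodic_partial_d[of f] in \<open>simp add: periodic_def grad_def\<close>)

lemma periodic_bernoulli_potential:
  assumes "periodic mb" "periodic rb"
  shows "periodic (bernoulli_potential U \<kappa> \<nu> mb rb)"
  using assms periodic_divg[OF assms(1)] periodic_laplacian[OF assms(2)]
  by (simp add: periodic_def bernoulli_potential_def mean_velocity_def)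

lemma periodic_mean_field:
  assumes "\<And>\<omega>. \<omega> \<in> space M \<Longrightarrow> periodic (G t \<omega>)"
  shows "periodic (mean_field M G t)"
  using assms unfolding periodic_def mean_field_def
  by (auto intro!: Bochner_Integration.integral_cong)

section \<open>Time-dependent fields\<close>

lemma continuous_on_Pair_compose:
  assumes "continuous_on (A \<times> UNIV) (\<lambda>(t, x). H t x)" "continuous_on (A \<times> B) (\<lambda>(t, s). P t s)"
  shows "continuous_on (A \<times> B) (\<lambda>(t, s). H t (P t s))"
proof -
  have "continuous_on (A \<times> B) (\<lambda>z. (case_prod H) (fst z, case_prod P z))"
    by (rule continuous_on_compose2[OF assms(1)]) (auto intro!: continuous_intros assms(2))
  then show ?thesis by (simp add: case_prod_beta')
qed

lemma time_Ck_SucD: "time_Ck (Suc k) T G \<Longrightarrow> time_Ck k T G"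
proof (induction k arbitrary: G)
  case 0
  then show ?case by simp
next
  case (Suc k)
  then show ?case by (metis time_Ck.simps(2))
qed

lemma time_Ck_mono: "j \<le> k \<Longrightarrow> time_Ck k T G \<Longrightarrow> time_Ck j T G"
  by (induction k rule: dec_induct) (use time_Ck_SucD in blast)+

lemma time_Ck_1_iff:
  "time_Ck 1 T G \<longleftrightarrow> continuous_on ({0..T} \<times> UNIV) (\<lambda>(t, x). G t x) \<and>
     (\<forall>t\<in>{0..T}. \<forall>x. G t differentiable (at x)) \<and>
     (\<forall>b\<in>Basis. continuous_on ({0..T} \<times> UNIV) (\<lambda>(t, x). frechet_derivative (G t) (at x) b))"
  by simp

lemma time_Ck_1I:
  assumes "continuous_on ({0..T} \<times> UNIV) (\<lambda>(t, x). G t x)"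
    and "\<And>t x. t \<in> {0..T} \<Longrightarrow> (G t has_derivative G' t x) (at x)"
    and "\<And>b. b \<in> Basis \<Longrightarrow> continuous_on ({0..T} \<times> UNIV) (\<lambda>(t, x). G' t x b)"
  shows "time_Ck 1 T G"
proof -
  have "continuous_on ({0..T} \<times> UNIV) (\<lambda>(t, x). frechet_derivative (G t) (at x) b)" if "b \<in> Basis" for b
    using assms(3)[OF that]
  proof (rule continuous_on_eq)
    fix z :: "real \<times> 'a"
    assume "z \<in> {0..T} \<times> UNIV"
    then show "(case z of (t, x) \<Rightarrow> G' t x b) = (case z of (t, x) \<Rightarrow> frechet_derivative (G t) (at x) b)"
      using frechet_derivative_at[OF assms(2)[of "fst z" "snd z"]] by (auto simp: case_prod_beta)
  qed
  then show ?thesis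
    using assms(1,2) unfolding time_Ck_1_iff by (blast intro: differentiableI)
qed

lemma time_Ck_1_has_derivative:
  "time_Ck 1 T G \<Longrightarrow> t \<in> {0..T} \<Longrightarrow> (G t has_derivative frechet_derivative (G t) (at x)) (at x)"
  unfolding time_Ck_1_iff by (simp add: frechet_derivative_works[symmetric])

lemma time_Ck_cong:
  assumes "\<And>t. t \<in> {0..T} \<Longrightarrow> G t = H t"
  shows "time_Ck k T G = time_Ck k T H"
  using assms
proof (induction k arbitrary: G H)
  case 0
  then show ?case by (auto intro!: continuous_on_cong)
next
  case (Suc k)
  have "time_Ck k T (\<lambda>t x. frechet_derivative (G t) (at x) b) = time_Ck k T (\<lambda>t x. frechet_derivative (H t) (at x) b)" for b
    by (rule Suc.IH) (use Suc.prems in simp)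
  moreover have "continuous_on ({0..T} \<times> UNIV) (\<lambda>(t, x). G t x) = continuous_on ({0..T} \<times> UNIV) (\<lambda>(t, x). H t x)"
    using Suc.prems by (auto intro!: continuous_on_cong)
  ultimately show ?case using Suc.prems by auto
qed

lemma time_Ck_vec_nth:
  "time_Ck k T G \<Longrightarrow> time_Ck k T (\<lambda>t x. G t x $ j)"
proof (induction k arbitrary: G)
  case 0
  then show ?case by (auto simp: case_prod_beta' intro: bounded_linear.continuous_on[OF bounded_linear_vec_nth])
next
  case (Suc k)
  have "time_Ck k T (\<lambda>t x. frechet_derivative (\<lambda>x. G t x $ j) (at x) b)" if "b \<in> Basis" for b
  proof -
    have "frechet_derivative (\<lambda>x. G t x $ j) (at x) b = frechet_derivative (G t) (at x) b $ j"
      if "t \<in> {0..T}" for t x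
    proof -
      have "(G t has_derivative frechet_derivative (G t) (at x)) (at x)"
        using Suc.prems that by (simp add: frechet_derivative_works[symmetric])
      from frechet_derivative_at[OF bounded_linear.has_derivative[OF bounded_linear_vec_nth this, of j], THEN fun_cong, of b]
      show ?thesis by simp
    qed
    then have "time_Ck k T (\<lambda>t x. frechet_derivative (\<lambda>x. G t x $ j) (at x) b) =
        time_Ck k T (\<lambda>t x. frechet_derivative (G t) (at x) b $ j)"
      by (intro time_Ck_cong) auto
    then show ?thesis
      using Suc.IH Suc.prems that by simp
  qed
  then show ?case
    using Suc.prems by (auto simp: case_prod_beta' intro: bounded_linear.continuous_on[OF bounded_linear_vec_nth] differentiable_vec_nth)
qed

lemma time_Ck_partial_d:
  "time_Ck (Suc k) T f \<Longrightarrow> time_Ck k T (\<lambda>t. partial_d i (f t))"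
  by (auto simp: partial_d_def[abs_def] Basis_vec_def)

lemma time_Ck_1_const: "time_Ck 1 T (\<lambda>t x. a)"
  by (rule time_Ck_1I[where G' = "\<lambda>t x h. 0"]) (auto simp: case_prod_beta')

lemma time_Ck_1_add:
  assumes "time_Ck 1 T f" "time_Ck 1 T g"
  shows "time_Ck 1 T (\<lambda>t x. f t x + g t x)"
proof (rule time_Ck_1I)
  show "((\<lambda>x. f t x + g t x) has_derivative
     (\<lambda>h. frechet_derivative (f t) (at x) h + frechet_derivative (g t) (at x) h)) (at x)"
    if "t \<in> {0..T}" for t x
    by (intro has_derivative_add time_Ck_1_has_derivative[OF _ that] assms)
qed (use assms[unfolded time_Ck_1_iff] in \<open>auto simp: case_prod_beta' intro!: continuous_on_add\<close>)

lemma time_Ck_1_mult: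
  fixes f g :: "real \<Rightarrow> 'a::euclidean_space \<Rightarrow> real"
  assumes "time_Ck 1 T f" "time_Ck 1 T g"
  shows "time_Ck 1 T (\<lambda>t x. f t x * g t x)"
proof (rule time_Ck_1I)
  show "((\<lambda>x. f t x * g t x) has_derivative
     (\<lambda>h. f t x * frechet_derivative (g t) (at x) h + frechet_derivative (f t) (at x) h * g t x)) (at x)"
    if "t \<in> {0..T}" for t x
    by (intro has_derivative_mult time_Ck_1_has_derivative[OF _ that] assms)
qed (use assms[unfolded time_Ck_1_iff] in \<open>auto simp: case_prod_beta' intro!: continuous_on_add continuous_on_mult\<close>)

lemma time_Ck_1_sum:
  assumes "finite I" "\<And>i. i \<in> I \<Longrightarrow> time_Ck 1 T (f i)"
  shows "time_Ck 1 T (\<lambda>t x. \<Sum>i\<in>I. f i t x)"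
  using assms
proof (induction I)
  case empty
  show ?case unfolding sum.empty by (rule time_Ck_1_const)
next
  case (insert i I)
  then show ?case
    using time_Ck_1_add[of T "f i"] by (simp del: time_Ck.simps One_nat_def)
qed

lemma time_Ck_1_compose:
  fixes f :: "real \<Rightarrow> 'a::euclidean_space \<Rightarrow> real" and h :: "real \<Rightarrow> real"
  assumes f: "time_Ck 1 T f" and pos: "\<And>t x. t \<in> {0..T} \<Longrightarrow> f t x \<in> S"
    and h: "\<And>y. y \<in> S \<Longrightarrow> (h has_real_derivative h' y) (at y)" "continuous_on S h'"
  shows "time_Ck 1 T (\<lambda>t x. h (f t x))"
proof (rule time_Ck_1I)
  show "((\<lambda>x. h (f t x)) has_derivative (\<lambda>k. h' (f t x) * frechet_derivative (f t) (at x) k)) (at x)"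
    if "t \<in> {0..T}" for t x
    using has_derivative_compose[OF time_Ck_1_has_derivative[OF f that]
        h(1)[OF pos[OF that], unfolded has_field_derivative_def]] .
  have cont: "continuous_on ({0..T} \<times> UNIV) (\<lambda>(t, x). f t x)"
    using f unfolding time_Ck_1_iff by blast
  have "continuous_on S h"
    using h(1) DERIV_continuous continuous_at_imp_continuous_on by blast
  from this h(2) have "continuous_on ({0..T} \<times> UNIV) (\<lambda>z. h (case_prod f z))"
    "continuous_on ({0..T} \<times> UNIV) (\<lambda>z. h' (case_prod f z))"
    by (auto intro!: continuous_on_compose2[OF _ cont] simp: pos)
  note h_cont = this
  show "continuous_on ({0..T} \<times> UNIV) (\<lambda>(t, x). h (f t x))"
    using h_cont(1) by (simp add: case_prod_beta')
  show "continuous_on ({0..T} \<times> UNIV) (\<lambda>(t, x). h' (f t x) * frechet_derivative (f t) (at x) b)"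
    if "b \<in> Basis" for b
    using h_cont(2) f[unfolded time_Ck_1_iff] that by (auto simp: case_prod_beta' intro!: continuous_on_mult)
qed

lemma time_Ck_1_divg:
  fixes X :: "real \<Rightarrow> real ^ 'n \<Rightarrow> real ^ 'n"
  assumes "time_Ck 2 T X"
  shows "time_Ck 1 T (\<lambda>t. divg (X t))"
proof -
  have "time_Ck 1 T (\<lambda>t. partial_d i (\<lambda>y. X t y $ i))" for i
    using assms by (intro time_Ck_partial_d time_Ck_vec_nth) (simp only: numeral_2_eq_2 One_nat_def)
  then show ?thesis
    unfolding divg_def[abs_def] by (intro time_Ck_1_sum) auto
qed

lemma time_Ck_1_laplacian:
  fixes f :: "real \<Rightarrow> real ^ 'n \<Rightarrow> real"
  assumes "time_Ck 3 T f"
  shows "time_Ck 1 T (\<lambda>t. laplacian (f t))"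
proof -
  have "time_Ck 1 T (\<lambda>t. partial_d i (partial_d i (f t)))" for i
    using assms by (intro time_Ck_partial_d) (simp only: numeral_3_eq_3 One_nat_def)
  then show ?thesis
    unfolding laplacian_def[abs_def] divg_def[abs_def] grad_def[abs_def] vec_lambda_beta
    by (intro time_Ck_1_sum) (auto simp: eta_contract_eq)
qed

lemma smooth_on_real_deriv:
  fixes f :: "real \<Rightarrow> real"
  assumes "open S" "smooth_on S f"
  shows "\<And>y. y \<in> S \<Longrightarrow> (f has_real_derivative deriv f y) (at y)"
    and "\<And>y. y \<in> S \<Longrightarrow> (deriv f has_real_derivative deriv (deriv f) y) (at y)"
    and "continuous_on S (deriv f)" "continuous_on S (deriv (deriv f))"
proof -
  have *: "(\<forall>y\<in>S. g differentiable (at y)) \<and> Ck_on k S (deriv g)" if "Ck_on (Suc k) S g" for k and g :: "real \<Rightarrow> real"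
  proof -
    have d: "g differentiable (at y)" if "y \<in> S" for y
      using \<open>Ck_on (Suc k) S g\<close> that by simp
    have "frechet_derivative g (at y) 1 = deriv g y" if "y \<in> S" for y
    proof -
      have "(g has_derivative (*) (deriv g y)) (at y)"
        using d[OF that] by (simp add: DERIV_deriv_iff_real_differentiable[symmetric] has_field_derivative_def)
      from frechet_derivative_at[OF this, THEN fun_cong, of 1] show ?thesis by simp
    qed
    moreover have "Ck_on k S (\<lambda>y. frechet_derivative g (at y) 1)"
      using that by simp
    ultimately have "Ck_on k S (deriv g)"
      by (rule Ck_on_cong[OF assms(1)])
    with d show ?thesis by blast
  qed
  have 1: "(\<forall>y\<in>S. f differentiable (at y)) \<and> Ck_on 2 S (deriv f)"
    using assms(2) by (intro *) (simp add: smooth_on_def del: Ck_on.simps)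
  then have 2: "(\<forall>y\<in>S. deriv f differentiable (at y)) \<and> Ck_on 1 S (deriv (deriv f))"
    by (intro *) (simp only: numeral_2_eq_2 One_nat_def)
  then have 3: "(\<forall>y\<in>S. deriv (deriv f) differentiable (at y))"
    by simp
  show "\<And>y. y \<in> S \<Longrightarrow> (f has_real_derivative deriv f y) (at y)"
    "\<And>y. y \<in> S \<Longrightarrow> (deriv f has_real_derivative deriv (deriv f) y) (at y)"
    using 1 2 by (simp_all add: DERIV_deriv_iff_real_differentiable)
  show "continuous_on S (deriv f)" "continuous_on S (deriv (deriv f))"
    using 2 3 by (auto intro!: continuous_at_imp_continuous_on differentiable_imp_continuous_within)
qed

lemma time_Ck_1_bernoulli_potential:
  fixes mb :: "real \<Rightarrow> real ^ 'n \<Rightarrow> real ^ 'n"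
  assumes U: "smooth_on {0<..} U" and mb: "time_Ck 2 T mb" and rb: "time_Ck 3 T rb"
    and pos: "\<And>t x. t \<in> {0..T} \<Longrightarrow> 0 < rb t x"
  shows "time_Ck 1 T (\<lambda>t. bernoulli_potential U \<kappa> \<nu> (mb t) (rb t))"
proof -
  have mb1: "time_Ck 1 T (\<lambda>t x. mb t x $ i)" for i
    by (intro time_Ck_vec_nth time_Ck_mono[OF _ mb]) simp
  have rb1: "time_Ck 1 T rb"
    by (rule time_Ck_mono[OF _ rb]) simp
  note U' = smooth_on_real_deriv[OF open_greaterThan U]
  have c: "time_Ck 1 T (\<lambda>t x. U (rb t x))" "time_Ck 1 T (\<lambda>t x. deriv U (rb t x))"
    by (rule time_Ck_1_compose[OF rb1, of "{0<..}", OF _ U'(1,3)] time_Ck_1_compose[OF rb1, of "{0<..}", OF _ U'(2,4)];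
        simp add: pos)+
  have inv: "time_Ck 1 T (\<lambda>t x. inverse (rb t x))"
    by (rule time_Ck_1_compose[OF rb1, of "{0<..}" inverse "\<lambda>y. - (inverse y * inverse y)"])
      (simp add: pos, auto intro!: derivative_eq_intros continuous_intros)
  have eq: "bernoulli_potential U \<kappa> \<nu> (mb t) (rb t) = (\<lambda>x.
      (\<Sum>i\<in>UNIV. (inverse (rb t x) * mb t x $ i) * (inverse (rb t x) * mb t x $ i)) * (1/2)
      + (- 1) * (rb t x * deriv U (rb t x) + U (rb t x))
      + \<kappa> * laplacian (rb t) x + \<nu> * (divg (mb t) x * inverse (rb t x)))" for t
    by (rule ext) (simp add: bernoulli_potential_def mean_velocity_def inner_vec_def inverse_eq_divide)
  show ?thesis
    unfolding eq
    by (intro time_Ck_1_add time_Ck_1_mult time_Ck_1_sum time_Ck_1_const time_Ck_1_laplacian[OF rb]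
        time_Ck_1_divg[OF mb] c inv mb1 rb1 finite)
qed

section \<open>Circulation along a moving loop\<close>

lemma closure_rational_interval:
  fixes a b :: real
  assumes "a < b"
  shows "closure ({a<..<b} \<inter> \<rat>) = {a..b}"
  using closure_convex_Int_superset[of "{a<..<b}" "\<rat>"] assms
  by (simp add: Rats_closure_real)

lemma conserved_integral:
  fixes f G :: "real \<Rightarrow> real \<Rightarrow> real"
  assumes T: "0 < T"
    and f: "continuous_on ({0..T} \<times> {0..1}) (\<lambda>(t, s). f t s)"
    and G: "continuous_on ({0..T} \<times> {0..1}) (\<lambda>(t, s). G t s)"
    and eq: "\<And>t s. t \<in> {0<..<T} \<inter> \<rat> \<Longrightarrow> s \<in> {0<..<1} \<inter> \<rat> \<Longrightarrow>
      f t s = f 0 s + integral {0..t} (\<lambda>r. G r s)"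
    and zero: "\<And>t. t \<in> {0..T} \<Longrightarrow> integral {0..1} (G t) = 0"
    and t: "t \<in> {0..T}"
  shows "integral {0..1} (f t) = integral {0..1} (f 0)"
proof -
  have f_slice: "continuous_on {0..1} (f t)" if "t \<in> {0..T}" for t
  proof -
    have "continuous_on {0..1} (\<lambda>s. case (t, s) of (t, s) \<Rightarrow> f t s)"
      by (rule continuous_on_compose2[OF f]) (use that in \<open>auto intro!: continuous_on_Pair continuous_on_id\<close>)
    then show ?thesis by simp
  qed
  have rational: "integral {0..1} (f t) = integral {0..1} (f 0)" if t: "t \<in> {0<..<T} \<inter> \<rat>" for t
  proof -
    have t': "t \<in> {0..T}" "0 \<le> t" using t by auto
    have "continuous_on (cbox (0, 0) (1, t)) (\<lambda>z. case prod.swap z of (r, s) \<Rightarrow> G r s)"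
      by (rule continuous_on_compose2[OF G]) (use t in \<open>auto simp: cbox_Pair_eq intro: continuous_on_swap\<close>)
    then have G': "continuous_on (cbox (0, 0) (1, t)) (\<lambda>(s, r). G r s)"
      by (simp add: case_prod_beta')
    have I: "continuous_on {0..1} (\<lambda>s. integral {0..t} (\<lambda>r. G r s))"
      using integral_continuous_on_param[of "{0..1}" 0 t "\<lambda>s r. G r s"] G' by (simp add: cbox_Pair_eq)
    have "f t s - f 0 s - integral {0..t} (\<lambda>r. G r s) = 0" if "s \<in> {0..1}" for s
    proof (rule continuous_constant_on_closure[where S = "{0<..<1} \<inter> \<rat>"
        and f = "\<lambda>s. f t s - f 0 s - integral {0..t} (\<lambda>r. G r s)"])
      show "continuous_on (closure ({0<..<1} \<inter> \<rat>)) (\<lambda>s. f t s - f 0 s - integral {0..t} (\<lambda>r. G r s))"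
        unfolding closure_rational_interval[OF zero_less_one]
        using T t' by (intro continuous_on_diff f_slice I) auto
    qed (use eq t that in \<open>simp_all add: closure_rational_interval del: Int_iff\<close>)
    then have "integral {0..1} (f t) = integral {0..1} (\<lambda>s. f 0 s + integral {0..t} (\<lambda>r. G r s))"
      by (intro Henstock_Kurzweil_Integration.integral_cong) (simp add: algebra_simps)
    also have "\<dots> = integral {0..1} (f 0) + integral {0..1} (\<lambda>s. integral {0..t} (\<lambda>r. G r s))"
      using f_slice[of 0] I T
      by (intro Henstock_Kurzweil_Integration.integral_add integrable_continuous_interval) auto
    also have "integral {0..1} (\<lambda>s. integral {0..t} (\<lambda>r. G r s)) = integral {0..t} (\<lambda>r. integral {0..1} (G r))"
      using integral_swap_continuous[OF G'] by simp
    also have "\<dots> = integral {0..t} (\<lambda>r. 0)"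
      by (rule Henstock_Kurzweil_Integration.integral_cong) (use zero t in auto)
    finally show ?thesis by simp
  qed
  have "integral {0..1} (f t) - integral {0..1} (f 0) = 0"
  proof (rule continuous_constant_on_closure[where S = "{0<..<T} \<inter> \<rat>"
        and f = "\<lambda>t. integral {0..1} (f t) - integral {0..1} (f 0)"])
    show "continuous_on (closure ({0<..<T} \<inter> \<rat>)) (\<lambda>t. integral {0..1} (f t) - integral {0..1} (f 0))"
      unfolding closure_rational_interval[OF T]
      by (intro continuous_on_diff continuous_on_const)
        (use integral_continuous_on_param[of "{0..T}" 0 1 f] f in simp)
  qed (use rational t in \<open>simp_all add: closure_rational_interval[OF T] del: Int_iff\<close>)
  then show ?thesis by simp
qed

lemma has_vector_derivative_compose_curve:
  fixes c :: "real \<Rightarrow> 'a::euclidean_space"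
  assumes "\<phi> differentiable (at (c s))" "c differentiable (at s)"
  shows "((\<phi> \<circ> c) has_vector_derivative
    frechet_derivative \<phi> (at (c s)) (frechet_derivative c (at s) 1)) (at s)"
proof -
  have "linear (frechet_derivative \<phi> (at (c s)) \<circ> frechet_derivative c (at s))"
    using assms by (intro linear_compose linear_frechet_derivative)
  from linear_scale[OF this, of _ 1]
  have A: "frechet_derivative \<phi> (at (c s)) (frechet_derivative c (at s) h) =
      h *\<^sub>R frechet_derivative \<phi> (at (c s)) (frechet_derivative c (at s) 1)" for h
    by (metis comp_apply mult.right_neutral real_scaleR_def)
  have B: "((\<lambda>s. \<phi> (c s)) has_derivative
      (\<lambda>h. frechet_derivative \<phi> (at (c s)) (frechet_derivative c (at s) h))) (at s)"
    using has_derivative_compose[of c _ s UNIV \<phi>] assms by (simp add: frechet_derivative_works)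
  show ?thesis
    unfolding has_vector_derivative_def comp_def
    by (rule has_derivative_eq_rhs[OF B]) (rule ext, rule A)
qed

lemma line_integral_push_forward:
  fixes \<phi> :: "real ^ 'n \<Rightarrow> real ^ 'n"
  assumes "\<And>s. \<phi> differentiable (at (c s))" "\<And>s. c differentiable (at s)"
  shows "line_integral (\<lambda>x h. inverse (q x) * flat_form m x h) (\<phi> \<circ> c) =
    integral {0..1} (\<lambda>s. (m (\<phi> (c s)) \<bullet> frechet_derivative \<phi> (at (c s)) (frechet_derivative c (at s) 1)) / q (\<phi> (c s)))"
proof -
  have "vector_derivative (\<phi> \<circ> c) (at s within {0..1}) =
      frechet_derivative \<phi> (at (c s)) (frechet_derivative c (at s) 1)" if "s \<in> {0..1}" for s
    by (rule vector_derivative_at_within_ivl[OF has_vector_derivative_compose_curve[OF assms]])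
      (use that in auto)
  then show ?thesis
    unfolding line_integral_def flat_form_def
    by (intro Henstock_Kurzweil_Integration.integral_cong) (simp add: divide_inverse)
qed

lemma exact_form_closed_loop:
  fixes c :: "real \<Rightarrow> real ^ 'n"
  assumes p: "periodic p" "\<And>x. (p has_derivative (\<lambda>h. grad p x \<bullet> h)) (at x)"
    and \<phi>: "\<And>x. \<phi> differentiable (at x)" "\<And>x k. k \<in> int_lattice \<Longrightarrow> \<phi> (x + k) = \<phi> x + k"
    and c: "\<And>s. c differentiable (at s)" "c 1 - c 0 \<in> int_lattice"
  shows "integral {0..1} (\<lambda>s. grad p (\<phi> (c s)) \<bullet> frechet_derivative \<phi> (at (c s)) (frechet_derivative c (at s) 1)) = 0"
    (is "integral _ ?G = 0")
proof -
  have "((\<lambda>s. p (\<phi> (c s))) has_vector_derivative ?G s) (at s within {0..1})" for s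
  proof -
    have "((\<phi> \<circ> c) has_derivative
        (\<lambda>h. h *\<^sub>R frechet_derivative \<phi> (at (c s)) (frechet_derivative c (at s) 1))) (at s)"
      using has_vector_derivative_compose_curve[of \<phi> c s, OF \<phi>(1) c(1)]
      by (simp only: has_vector_derivative_def)
    from has_derivative_compose[OF this p(2)]
    have "((\<lambda>s. p (\<phi> (c s))) has_vector_derivative ?G s) (at s)"
      by (simp add: has_vector_derivative_def)
    then show ?thesis by (rule has_vector_derivative_at_within)
  qed
  then have "(?G has_integral p (\<phi> (c 1)) - p (\<phi> (c 0))) {0..1}"
    by (intro fundamental_theorem_of_calculus) auto
  moreover have "p (\<phi> (c 1)) = p (\<phi> (c 0))"
    using \<phi>(2)[OF c(2), of "c 0"] p(1) c(2) by (simp add: periodic_def)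
  ultimately show ?thesis by (simp add: integral_unique)
qed

lemma continuous_on_curve_push_forward:
  fixes c :: "real \<Rightarrow> real ^ 'n" and \<Phi> :: "real \<Rightarrow> real ^ 'n \<Rightarrow> real ^ 'n"
  assumes \<Phi>: "time_Ck 1 T \<Phi>" and c: "continuous_on S c" "continuous_on S c'"
  shows "continuous_on ({0..T} \<times> S) (\<lambda>(t, s). \<Phi> t (c s))"
    and "continuous_on ({0..T} \<times> S) (\<lambda>(t, s). frechet_derivative (\<Phi> t) (at (c s)) (c' s))"
proof -
  have c2: "continuous_on ({0..T} \<times> S) (\<lambda>(t, s). c s)" "continuous_on ({0..T} \<times> S) (\<lambda>(t, s). c' s)"
    unfolding case_prod_beta'
    by (rule continuous_on_compose2[OF c(1)] continuous_on_compose2[OF c(2)];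
        force intro: continuous_on_snd continuous_on_id)+
  show "continuous_on ({0..T} \<times> S) (\<lambda>(t, s). \<Phi> t (c s))"
    using \<Phi> unfolding time_Ck_1_iff by (intro continuous_on_Pair_compose[OF _ c2(1)]) blast
  have "continuous_on ({0..T} \<times> S) (\<lambda>(t, s). frechet_derivative (\<Phi> t) (at (c s)) (axis i 1))" for i
  proof (rule continuous_on_Pair_compose[OF _ c2(1)])
    have "axis i (1::real) \<in> Basis"
      by (auto simp: Basis_vec_def)
    then show "continuous_on ({0..T} \<times> UNIV) (\<lambda>(t, x). frechet_derivative (\<Phi> t) (at x) (axis i 1))"
      using \<Phi> unfolding time_Ck_1_iff by blast
  qed
  then have "continuous_on ({0..T} \<times> S)
      (\<lambda>(t, s). \<Sum>i\<in>UNIV. c' s $ i *\<^sub>R frechet_derivative (\<Phi> t) (at (c s)) (axis i 1))"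
    using c2(2) unfolding case_prod_beta'
    by (intro continuous_on_sum continuous_on_scaleR bounded_linear.continuous_on[OF bounded_linear_vec_nth])
  then show "continuous_on ({0..T} \<times> S) (\<lambda>(t, s). frechet_derivative (\<Phi> t) (at (c s)) (c' s))"
  proof (rule continuous_on_eq)
    fix z assume "z \<in> {0..T} \<times> S"
    then show "(case z of (t, s) \<Rightarrow> \<Sum>i\<in>UNIV. c' s $ i *\<^sub>R frechet_derivative (\<Phi> t) (at (c s)) (axis i 1)) =
      (case z of (t, s) \<Rightarrow> frechet_derivative (\<Phi> t) (at (c s)) (c' s))"
      using \<Phi> linear_axis_expansion[OF linear_frechet_derivative[of "\<Phi> (fst z)" "at (c (snd z))"], of "c' (snd z)"]
      unfolding time_Ck_1_iff by auto
  qed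
qed

theorem proposition4p1:
  fixes M :: "'w measure"
    and F :: "real \<Rightarrow> 'w measure"
    and R :: "'r set"
    and W :: "'r \<Rightarrow> real \<Rightarrow> 'w \<Rightarrow> real"
    and T \<kappa> \<nu> \<epsilon> :: real
    and U :: "real \<Rightarrow> real"
    and \<xi> :: "'r \<Rightarrow> real ^ 'n \<Rightarrow> real ^ 'n"
    and \<mu> :: "real \<Rightarrow> 'w \<Rightarrow> real ^ 'n \<Rightarrow> real ^ 'n"
    and \<rho> :: "real \<Rightarrow> 'w \<Rightarrow> real ^ 'n \<Rightarrow> real"
    and mb :: "real \<Rightarrow> real ^ 'n \<Rightarrow> real ^ 'n"
    and rb :: "real \<Rightarrow> real ^ 'n \<Rightarrow> real"
    and v :: "real \<Rightarrow> real ^ 'n \<Rightarrow> real ^ 'n"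
    and \<Phi> :: "real \<Rightarrow> 'w \<Rightarrow> real ^ 'n \<Rightarrow> real ^ 'n"
    and c :: "real \<Rightarrow> real ^ 'n"
  assumes prob: "prob_space M"
    and usual: "usual_conditions M F"
    and R: "finite R"
    and W: "independent_brownian_motions M F R W"
    and T: "0 < T"
    and nonneg: "0 \<le> \<kappa>" "0 \<le> \<nu>" "0 \<le> \<epsilon>"
    and U: "smooth_on {0<..} U"
    and \<xi>: "\<And>r. r \<in> R \<Longrightarrow> periodic (\<xi> r) \<and> smooth_on UNIV (\<xi> r) \<and> (\<forall>x. divg (\<xi> r) x = 0)"
    \<comment> \<open>fields on the torus, adapted and regular\<close>
    and \<mu>_reg: "\<And>\<omega>. \<omega> \<in> space M \<Longrightarrow> (\<forall>t\<in>{0..T}. periodic (\<mu> t \<omega>)) \<and> time_Ck 1 T (\<lambda>t. \<mu> t \<omega>)"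
    and \<rho>_reg: "\<And>\<omega>. \<omega> \<in> space M \<Longrightarrow> (\<forall>t\<in>{0..T}. periodic (\<rho> t \<omega>)) \<and> time_Ck 1 T (\<lambda>t. \<rho> t \<omega>)"
    and adapted: "\<And>x. adapted_on F T (\<lambda>t \<omega>. \<mu> t \<omega> x) \<and> adapted_on F T (\<lambda>t \<omega>. \<rho> t \<omega> x)"
    and \<rho>_pos: "\<And>t \<omega> x. t \<in> {0..T} \<Longrightarrow> \<omega> \<in> space M \<Longrightarrow> 0 < \<rho> t \<omega> x"
    and integrable: "\<And>t x. t \<in> {0..T} \<Longrightarrow>
        integrable M (\<lambda>\<omega>. \<mu> t \<omega> x) \<and> integrable M (\<lambda>\<omega>. \<rho> t \<omega> x)"
    \<comment> \<open>mean fields and transport velocity\<close>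
    and mb: "mb = mean_field M \<mu>"
    and rb: "rb = mean_field M \<rho>"
    and mean_reg: "time_Ck 2 T mb" "time_Ck 3 T rb"
    and rb_pos: "\<And>t x. t \<in> {0..T} \<Longrightarrow> 0 < rb t x"
    and v: "v = (\<lambda>t. transport_velocity \<nu> (mb t) (rb t))"
    \<comment> \<open>the mean field system\<close>
    and momentum_eq: "has_field_differential M F R W T \<mu>
        (\<lambda>t \<omega>. momentum_drift U \<kappa> \<nu> (mb t) (rb t) (\<mu> t \<omega>) (\<rho> t \<omega>))
        (\<lambda>r t \<omega>. momentum_noise \<epsilon> (\<xi> r) (\<mu> t \<omega>))"
    and density_eq: "has_field_differential M F R W T \<rho>
        (\<lambda>t \<omega>. density_drift \<nu> (mb t) (rb t) (\<rho> t \<omega>))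
        (\<lambda>r t \<omega>. density_noise \<epsilon> (\<xi> r) (\<rho> t \<omega>))"
    \<comment> \<open>the Lagrangian flow\<close>
    and flow: "stochastic_flow M F R W T \<Phi> v (\<lambda>r x. \<epsilon> *\<^sub>R \<xi> r x)"
    and \<Phi>_reg: "\<And>\<omega>. \<omega> \<in> space M \<Longrightarrow> time_Ck 1 T (\<lambda>t. \<Phi> t \<omega>)"
    \<comment> \<open>the rules of Stratonovich calculus apply\<close>
    and ito_wentzell_\<mu>: "ito_wentzell_applies M F R W T \<mu>
        (\<lambda>t \<omega>. momentum_drift U \<kappa> \<nu> (mb t) (rb t) (\<mu> t \<omega>) (\<rho> t \<omega>))
        (\<lambda>r t \<omega>. momentum_noise \<epsilon> (\<xi> r) (\<mu> t \<omega>))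
        \<Phi> v (\<lambda>r x. \<epsilon> *\<^sub>R \<xi> r x)"
    and ito_wentzell_\<rho>: "ito_wentzell_applies M F R W T \<rho>
        (\<lambda>t \<omega>. density_drift \<nu> (mb t) (rb t) (\<rho> t \<omega>))
        (\<lambda>r t \<omega>. density_noise \<epsilon> (\<xi> r) (\<rho> t \<omega>))
        \<Phi> v (\<lambda>r x. \<epsilon> *\<^sub>R \<xi> r x)"
    and flow_derivative: "flow_derivative_applies M F R W T \<Phi> v (\<lambda>r x. \<epsilon> *\<^sub>R \<xi> r x)"
    and chain_rule: "\<And>x h. chain_rule_applies M F R W T
        (\<lambda>t \<omega>. (\<mu> t \<omega> (\<Phi> t \<omega> x), \<rho> t \<omega> (\<Phi> t \<omega> x), frechet_derivative (\<Phi> t \<omega>) (at x) h))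
        (\<lambda>t \<omega>.
          (material_derivative (\<mu> t \<omega>)
             (momentum_drift U \<kappa> \<nu> (mb t) (rb t) (\<mu> t \<omega>) (\<rho> t \<omega>)) (v t) (\<Phi> t \<omega> x),
           material_derivative (\<rho> t \<omega>)
             (density_drift \<nu> (mb t) (rb t) (\<rho> t \<omega>)) (v t) (\<Phi> t \<omega> x),
           frechet_derivative (\<lambda>y. v t (\<Phi> t \<omega> y)) (at x) h))
        (\<lambda>r t \<omega>.
          (material_derivative (\<mu> t \<omega>)
             (momentum_noise \<epsilon> (\<xi> r) (\<mu> t \<omega>)) (\<lambda>y. \<epsilon> *\<^sub>R \<xi> r y) (\<Phi> t \<omega> x),
           material_derivative (\<rho> t \<omega>)
             (density_noise \<epsilon> (\<xi> r) (\<rho> t \<omega>)) (\<lambda>y. \<epsilon> *\<^sub>R \<xi> r y) (\<Phi> t \<omega> x),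
           frechet_derivative (\<lambda>y. \<epsilon> *\<^sub>R \<xi> r (\<Phi> t \<omega> y)) (at x) h))"
    \<comment> \<open>a smooth closed loop\<close>
    and c: "smooth_on UNIV c" "c 1 - c 0 \<in> int_lattice"
  shows "has_stratonovich_differential M F R W T
           (\<lambda>t \<omega>. line_integral (\<lambda>x h. inverse (\<rho> t \<omega> x) * flat_form (\<mu> t \<omega>) x h) (\<Phi> t \<omega> \<circ> c))
           (\<lambda>t \<omega>. 0) (\<lambda>r t \<omega>. 0) \<and>
         (AE \<omega> in M. \<forall>t\<in>{0..T}.
            line_integral (\<lambda>x h. inverse (\<rho> t \<omega> x) * flat_form (\<mu> t \<omega>) x h) (\<Phi> t \<omega> \<circ> c) =
            line_integral (\<lambda>x h. inverse (\<rho> 0 \<omega> x) * flat_form (\<mu> 0 \<omega>) x h) (\<Phi> 0 \<omega> \<circ> c))"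
proof -
  interpret prob_space M by fact
  have sub: "subalgebra M (F t)" for t
    using usual by (simp add: usual_conditions_def)
  note flow_defs = flow[unfolded stochastic_flow_def]
  define \<psi> where "\<psi> t = bernoulli_potential U \<kappa> \<nu> (mb t) (rb t)" for t
  define c' where "c' s = frechet_derivative c (at s) 1" for s
  define f where "f \<omega> t s = (\<mu> t \<omega> (\<Phi> t \<omega> (c s)) \<bullet> frechet_derivative (\<Phi> t \<omega>) (at (c s)) (c' s)) / \<rho> t \<omega> (\<Phi> t \<omega> (c s))"
    for \<omega> t s
  define G where "G \<omega> t s = grad (\<psi> t) (\<Phi> t \<omega> (c s)) \<bullet> frechet_derivative (\<Phi> t \<omega>) (at (c s)) (c' s)"
    for \<omega> t s

  have c_diff: "c differentiable (at s)" and c'_cont: "continuous_on UNIV c'" for s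
    using c(1)[unfolded smooth_on_def, rule_format, of 1] by (simp_all add: c'_def[abs_def])
  then have c_cont: "continuous_on UNIV c"
    by (auto intro!: continuous_at_imp_continuous_on differentiable_imp_continuous_within)
  have \<Phi>_diff: "\<Phi> t \<omega> differentiable (at x)" if "t \<in> {0..T}" "\<omega> \<in> space M" for t \<omega> x
    using \<Phi>_reg[OF that(2)] that(1) unfolding time_Ck_1_iff by blast
  have \<Phi>_shift: "\<Phi> t \<omega> (x + k) = \<Phi> t \<omega> x + k"
    if "t \<in> {0..T}" "\<omega> \<in> space M" "k \<in> int_lattice" for t \<omega> x k
    using flow_defs that by (auto simp: torus_diffeo_def)
  have \<mu>_diff: "\<mu> t \<omega> differentiable (at x)" and \<rho>_diff: "\<rho> t \<omega> differentiable (at x)"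
    if "t \<in> {0..T}" "\<omega> \<in> space M" for t \<omega> x
    using \<mu>_reg[OF that(2)] \<rho>_reg[OF that(2)] that(1) unfolding time_Ck_1_iff by blast+

  have mb_diff: "mb t differentiable (at x)" and rb_diff: "rb t differentiable (at x)"
    and div_diff: "divg (mb t) differentiable (at x)" and lap_diff: "laplacian (rb t) differentiable (at x)"
    and part_diff: "partial_d i (rb t) differentiable (at x)" if "t \<in> {0..T}" for t x i
  proof -
    have "time_Ck 1 T mb" by (rule time_Ck_mono[OF _ mean_reg(1)]) simp
    moreover have "time_Ck 1 T rb" by (rule time_Ck_mono[OF _ mean_reg(2)]) simp
    moreover have "time_Ck 1 T (\<lambda>t. partial_d i (rb t))"
      by (rule time_Ck_partial_d, rule time_Ck_mono[OF _ mean_reg(2)]) simp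
    moreover note time_Ck_1_divg[OF mean_reg(1)] time_Ck_1_laplacian[OF mean_reg(2)]
    ultimately show "mb t differentiable (at x)" "rb t differentiable (at x)"
      "divg (mb t) differentiable (at x)" "laplacian (rb t) differentiable (at x)"
      "partial_d i (rb t) differentiable (at x)"
      using that unfolding time_Ck_1_iff by blast+
  qed
  have u_diff: "mean_velocity (mb t) (rb t) differentiable (at x)" if "t \<in> {0..T}" for t x
    unfolding mean_velocity_def[abs_def]
    using that rb_pos[OF that, of x] by (intro differentiable_divide_scaleR mb_diff rb_diff) auto
  have ln_diff: "grad (\<lambda>y. ln (rb t y)) differentiable (at x)" if t: "t \<in> {0..T}" for t x
  proof -
    have "grad (\<lambda>y. ln (rb t y)) = (\<lambda>x. (1 / rb t x) *\<^sub>R grad (rb t) x)"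
      using grad_ln[OF rb_diff[OF t] rb_pos[OF t]] by blast
    moreover have "grad (rb t) differentiable (at x)"
      by (rule differentiable_vec_lambda) (simp add: grad_def part_diff[OF t])
    ultimately show ?thesis
      using rb_pos[OF t, of x] by (simp add: differentiable_divide_scaleR rb_diff[OF t])
  qed
  have v_diff: "v t differentiable (at x)" if "t \<in> {0..T}" for t x
    unfolding v transport_velocity_def[abs_def]
    by (intro differentiable_add differentiable_scaleR differentiable_const u_diff ln_diff that)
  have U_diff: "U differentiable (at (rb t x))" "deriv U differentiable (at (rb t x))" if "t \<in> {0..T}" for t x
    using smooth_on_real_deriv(1,2)[OF open_greaterThan U] rb_pos[OF that, of x]
    by (auto simp: real_differentiable_def)

  have \<psi>_reg: "time_Ck 1 T \<psi>"
    unfolding \<psi>_def[abs_def] by (rule time_Ck_1_bernoulli_potential[OF U mean_reg rb_pos])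
  have \<psi>_deriv: "(\<psi> t has_derivative (\<lambda>h. grad (\<psi> t) x \<bullet> h)) (at x)" if "t \<in> {0..T}" for t x
    by (rule has_derivative_grad) (use \<psi>_reg that in \<open>unfold time_Ck_1_iff, blast\<close>)
  have \<psi>_periodic: "periodic (\<psi> t)" if "t \<in> {0..T}" for t
    unfolding \<psi>_def mb rb
    by (intro periodic_bernoulli_potential periodic_mean_field) (use \<mu>_reg \<rho>_reg that in blast)+

  have f_cont: "continuous_on ({0..T} \<times> {0..1}) (\<lambda>(t, s). f \<omega> t s)"
    and G_cont: "continuous_on ({0..T} \<times> {0..1}) (\<lambda>(t, s). G \<omega> t s)" if \<omega>: "\<omega> \<in> space M" for \<omega>
  proof -
    note \<Phi>c = continuous_on_curve_push_forward[OF \<Phi>_reg[OF \<omega>]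
        continuous_on_subset[OF c_cont subset_UNIV] continuous_on_subset[OF c'_cont subset_UNIV]]
    have m: "continuous_on ({0..T} \<times> {0..1}) (\<lambda>(t, s). \<mu> t \<omega> (\<Phi> t \<omega> (c s)))"
      and q: "continuous_on ({0..T} \<times> {0..1}) (\<lambda>(t, s). \<rho> t \<omega> (\<Phi> t \<omega> (c s)))"
      by (rule continuous_on_Pair_compose[OF _ \<Phi>c(1)];
          use \<mu>_reg[OF \<omega>] \<rho>_reg[OF \<omega>] in \<open>unfold time_Ck_1_iff, blast\<close>)+
    show "continuous_on ({0..T} \<times> {0..1}) (\<lambda>(t, s). f \<omega> t s)"
      unfolding f_def case_prod_beta'
    proof (intro continuous_on_divide continuous_on_inner)
      show "\<forall>z\<in>{0..T} \<times> {0..1}. \<rho> (fst z) \<omega> (\<Phi> (fst z) \<omega> (c (snd z))) \<noteq> 0"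
        using \<rho>_pos[OF _ \<omega>] by (metis less_irrefl mem_Times_iff)
    qed (use m q \<Phi>c(2) in \<open>simp_all add: case_prod_beta'\<close>)
    have "continuous_on ({0..T} \<times> UNIV) (\<lambda>(t, x). grad (\<psi> t) x)"
    proof -
      have "continuous_on ({0..T} \<times> UNIV) (\<lambda>(t, x). partial_d i (\<psi> t) x)" for i
      proof -
        have "axis i (1::real) \<in> Basis"
          by (auto simp: Basis_vec_def)
        then show ?thesis
          using \<psi>_reg unfolding time_Ck_1_iff partial_d_def by blast
      qed
      then show ?thesis
        unfolding grad_def case_prod_beta' by (intro continuous_on_vec_lambda)
    qed
    from continuous_on_Pair_compose[OF this \<Phi>c(1)] \<Phi>c(2)
    show "continuous_on ({0..T} \<times> {0..1}) (\<lambda>(t, s). G \<omega> t s)"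
      unfolding G_def case_prod_beta' by (rule continuous_on_inner)
  qed
  have G_zero: "integral {0..1} (G \<omega> t) = 0" if "\<omega> \<in> space M" "t \<in> {0..T}" for \<omega> t
    unfolding G_def[abs_def] c'_def
    by (rule exact_form_closed_loop)
      (use that \<psi>_periodic \<psi>_deriv \<Phi>_diff \<Phi>_shift c_diff c(2) in auto)

  have transport: "AE \<omega> in M. f \<omega> t s = f \<omega> 0 s + integral {0..t} (\<lambda>r. G \<omega> r s)"
    if t: "t \<in> {0..T}" for t s
  proof -
    let ?g = "\<lambda>z::(real ^ 'n) \<times> real \<times> (real ^ 'n). (fst z \<bullet> snd (snd z)) / fst (snd z)"
    let ?Z = "\<lambda>t \<omega>. (\<mu> t \<omega> (\<Phi> t \<omega> (c s)), \<rho> t \<omega> (\<Phi> t \<omega> (c s)), frechet_derivative (\<Phi> t \<omega>) (at (c s)) (c' s))"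
    note Z = has_stratonovich_differential_Pair[OF prob sub
        ito_wentzell_\<mu>[unfolded ito_wentzell_applies_def, rule_format, OF conjI, OF momentum_eq flow,
          unfolded has_field_differential_def, rule_format, of "c s"]
        has_stratonovich_differential_Pair[OF prob sub
          ito_wentzell_\<rho>[unfolded ito_wentzell_applies_def, rule_format, OF conjI, OF density_eq flow,
            unfolded has_field_differential_def, rule_format, of "c s"]
          flow_derivative[unfolded flow_derivative_applies_def, rule_format, OF flow,
            unfolded has_field_differential_def, rule_format, of "c s" "c' s"]]]
    have S: "open {z::(real ^ 'n) \<times> real \<times> (real ^ 'n). 0 < fst (snd z)}"
      by (intro open_Collect_less continuous_intros)
    note gZ = chain_rule[unfolded chain_rule_applies_def, rule_format, OF Z, of "{z. 0 < fst (snd z)}" ?g]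
    have "AE \<omega> in M. ?g (?Z t \<omega>) = ?g (?Z 0 \<omega>) + integral {0..t} (\<lambda>r. G \<omega> r s)"
    proof (rule noiseless_differential_AE[OF prob R gZ _ _ t])
      show "open {z::(real ^ 'n) \<times> real \<times> (real ^ 'n). 0 < fst (snd z)} \<and> smooth_on {z. 0 < fst (snd z)} ?g \<and>
          (\<forall>t\<in>{0..T}. \<forall>\<omega>\<in>space M. ?Z t \<omega> \<in> {z. 0 < fst (snd z)})"
        using S smooth_on_inner_divide \<rho>_pos by auto
    next
      fix r \<omega> assume r: "r \<in> {0..T}" and \<omega>: "\<omega> \<in> space M"
      have "frechet_derivative (\<lambda>y. v r (\<Phi> r \<omega> y)) (at (c s)) (c' s) =
          frechet_derivative (v r) (at (\<Phi> r \<omega> (c s))) (frechet_derivative (\<Phi> r \<omega>) (at (c s)) (c' s))"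
        using frechet_derivative_scaleR_compose[OF v_diff[OF r] \<Phi>_diff[OF r \<omega>], of 1] by simp
      then show "frechet_derivative ?g (at (?Z r \<omega>))
         (material_derivative (\<mu> r \<omega>)
            (momentum_drift U \<kappa> \<nu> (mb r) (rb r) (\<mu> r \<omega>) (\<rho> r \<omega>)) (v r) (\<Phi> r \<omega> (c s)),
          material_derivative (\<rho> r \<omega>)
            (density_drift \<nu> (mb r) (rb r) (\<rho> r \<omega>)) (v r) (\<Phi> r \<omega> (c s)),
          frechet_derivative (\<lambda>y. v r (\<Phi> r \<omega> y)) (at (c s)) (c' s)) = G \<omega> r s"
        unfolding G_def \<psi>_def v
        using circulation_density_drift[OF u_diff[OF r] ln_diff[OF r] div_diff[OF r] rb_diff[OF r] rb_pos[OF r]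
            lap_diff[OF r] U_diff[OF r] \<mu>_diff[OF r \<omega>] \<rho>_diff[OF r \<omega>] \<rho>_pos[OF r \<omega>]]
        by simp
    next
      fix i r \<omega> assume i: "i \<in> R" and r: "r \<in> {0..T}" and \<omega>: "\<omega> \<in> space M"
      have \<xi>_diff: "\<xi> i differentiable (at x)" for x
        using \<xi>[OF i, THEN conjunct2, THEN conjunct1, unfolded smooth_on_def, rule_format, of 1] by simp
      show "frechet_derivative ?g (at (?Z r \<omega>))
         (material_derivative (\<mu> r \<omega>)
            (momentum_noise \<epsilon> (\<xi> i) (\<mu> r \<omega>)) (\<lambda>y. \<epsilon> *\<^sub>R \<xi> i y) (\<Phi> r \<omega> (c s)),
          material_derivative (\<rho> r \<omega>)
            (density_noise \<epsilon> (\<xi> i) (\<rho> r \<omega>)) (\<lambda>y. \<epsilon> *\<^sub>R \<xi> i y) (\<Phi> r \<omega> (c s)),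
          frechet_derivative (\<lambda>y. \<epsilon> *\<^sub>R \<xi> i (\<Phi> r \<omega> y)) (at (c s)) (c' s)) = 0"
        unfolding frechet_derivative_scaleR_compose[OF \<xi>_diff \<Phi>_diff[OF r \<omega>]]
        using \<xi>[OF i] by (intro circulation_density_noise_cancels \<xi>_diff \<mu>_diff[OF r \<omega>] \<rho>_diff[OF r \<omega>] \<rho>_pos[OF r \<omega>]) blast
    qed
    then show ?thesis by (simp add: f_def)
  qed

  have "AE \<omega> in M. \<forall>t\<in>{0<..<T} \<inter> \<rat>. \<forall>s\<in>{0<..<1} \<inter> \<rat>. f \<omega> t s = f \<omega> 0 s + integral {0..t} (\<lambda>r. G \<omega> r s)"
    by (intro AE_ball_countable' transport countable_Int2 countable_rat) auto
  with AE_space have conserved: "AE \<omega> in M. \<forall>t\<in>{0..T}.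
      line_integral (\<lambda>x h. inverse (\<rho> t \<omega> x) * flat_form (\<mu> t \<omega>) x h) (\<Phi> t \<omega> \<circ> c) =
      line_integral (\<lambda>x h. inverse (\<rho> 0 \<omega> x) * flat_form (\<mu> 0 \<omega>) x h) (\<Phi> 0 \<omega> \<circ> c)"
  proof eventually_elim
    case (elim \<omega>)
    have L: "line_integral (\<lambda>x h. inverse (\<rho> t \<omega> x) * flat_form (\<mu> t \<omega>) x h) (\<Phi> t \<omega> \<circ> c) = integral {0..1} (f \<omega> t)"
      if "t \<in> {0..T}" for t
      unfolding f_def[abs_def] c'_def
      by (rule line_integral_push_forward[OF \<Phi>_diff[OF that elim(1)] c_diff])
    have I: "integral {0..1} (f \<omega> t) = integral {0..1} (f \<omega> 0)" if "t \<in> {0..T}" for t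
      by (rule conserved_integral[OF T f_cont[OF elim(1)] G_cont[OF elim(1)] _ G_zero[OF elim(1)] that])
        (use elim(2) in blast)
    have "0 \<in> {0..T}" using T by simp
    from L[OF this] show ?case using L I by metis
  qed
  show ?thesis
    using has_stratonovich_differential_constant[OF W conserved] conserved by blast
qed

end
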